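(* Let $r\ge 1$ be an integer and let $Z(r)$ be the Young–Fibonacci $r$-differential poset. Write $p_n$ for the number of elements of rank $n$ in $Z(r)$, with $p_k:=0$ for $k<0$, and $\Delta p_n:=p_n-p_{n-1}$. Then: (1) for every $n\ge 0$, the matrix $DU_n+tI$ in $\mathbb{Z}[t]^{p_n\times p_n}$ has a Smith form over $\mathbb{Z}[t]$; (2) for every $n\ge 1$ and every $1\le j\le n$ one has $\Delta p_n\ge \Delta p_{n-j-\delta_{r,1}}$ (i.e. $\Delta p_n\ge\Delta p_{n-j-1}$ if $r=1$, and $\Delta p_n\ge \Delta p_{n-j}$ if $r\ge 2$); (3) for every $n\ge 0$, the cokernel of $U_n:\mathbb{Z}^{p_n}\to\mathbb{Z}^{p_{n+1}}$ is a free abelian group.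
   Context: $Z(r)$ is the set of all finite words in the alphabet $\{1_1,1_2,\dots,1_r,2\}$; the rank of a word is the sum of its letters, where each $1_i$ has value $1$ and $2$ has value $2$ (the empty word is the minimum, of rank $0$). A word $w$ covers a word $w'$ if either (a) $w'$ is obtained from $w$ by changing a letter $2$ into some $1_i$, provided only letters $2$ occur to the left of it, or (b) $w'$ is obtained from $w$ by deleting its first (leftmost) letter of the form $1_i$. This is an $r$-differential poset. For a graded poset $P$ with rank sets $P_n$, $p_n=|P_n|$, the up map $U_n:\mathbb{Z}^{P_n}\to\mathbb{Z}^{P_{n+1}}$ sends each basis element $x$ to the sum of all elements covering $x$, and the down map $D_n:\mathbb{Z}^{P_n}\to\mathbb{Z}^{P_{n-1}}$ sends $x$ to the sum of all elements covered by $x$ (so $D_{n+1}=U_n^t$); $DU_n:=D_{n+1}U_n$, viewed as a $p_n\times p_n$ integer matrix in the basis $P_n$. A matrix $B$ over a commutative ring $S$ is in Smith form if it is diagonal (off-diagonal entries zero) with diagonal entries $s_1,s_2,\dots$ such that $s_i$ divides $s_{i+1}$ in $S$ for all $i$; $B$ has a Smith form over $S$ if $PBQ$ is in Smith form for some invertible matrices $P,Q$ over $S$. *)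

theory Defs
  imports "Jordan_Normal_Form.Matrix" "HOL-Computational_Algebra.Polynomial"
    "HOL-Algebra.Free_Abelian_Groups"
begin

text \<open>Letters: One i stands for the letter 1_i (meaningful for 1 <= i <= r), Two for the letter 2.\<close>
datatype letter = One nat | Two

definition valid_word :: "nat \<Rightarrow> letter list \<Rightarrow> bool" where
  "valid_word r w \<longleftrightarrow> (\<forall>i. One i \<in> set w \<longrightarrow> 1 \<le> i \<and> i \<le> r)"

fun letter_val :: "letter \<Rightarrow> nat" where
  "letter_val (One i) = 1"
| "letter_val Two = 2"

definition word_rank :: "letter list \<Rightarrow> nat" where
  "word_rank w = sum_list (map letter_val w)"

definition covers :: "nat \<Rightarrow> letter list \<Rightarrow> letter list \<Rightarrow> bool" where
  "covers r w w' \<longleftrightarrow> valid_word r w \<and> valid_word r w' \<and>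
     ((\<exists>k i v. 1 \<le> i \<and> i \<le> r \<and> w = replicate k Two @ Two # v \<and> w' = replicate k Two @ One i # v)
    \<or> (\<exists>k i v. w = replicate k Two @ One i # v \<and> w' = replicate k Two @ v))"

definition Pset :: "nat \<Rightarrow> nat \<Rightarrow> letter list set" where
  "Pset r n = {w. valid_word r w \<and> word_rank w = n}"

definition Plist :: "nat \<Rightarrow> nat \<Rightarrow> letter list list" where
  "Plist r n = (SOME xs. distinct xs \<and> set xs = Pset r n)"

definition pcard :: "nat \<Rightarrow> nat \<Rightarrow> nat" where
  "pcard r n = card (Pset r n)"

definition pz :: "nat \<Rightarrow> int \<Rightarrow> int" where
  "pz r k = (if k < 0 then 0 else int (pcard r (nat k)))"

definition dp :: "nat \<Rightarrow> int \<Rightarrow> int" where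
  "dp r k = pz r k - pz r (k - 1)"

definition Umat :: "nat \<Rightarrow> nat \<Rightarrow> int mat" where
  "Umat r n = mat (pcard r (Suc n)) (pcard r n)
     (\<lambda>(i, j). if covers r (Plist r (Suc n) ! i) (Plist r n ! j) then 1 else 0)"

definition Dmat :: "nat \<Rightarrow> nat \<Rightarrow> int mat" where
  "Dmat r n = transpose_mat (Umat r (n - 1))"

definition DUmat :: "nat \<Rightarrow> nat \<Rightarrow> int mat" where
  "DUmat r n = Dmat r (Suc n) * Umat r n"

definition DUt :: "nat \<Rightarrow> nat \<Rightarrow> int poly mat" where
  "DUt r n = map_mat (\<lambda>a. [:a:]) (DUmat r n) + [:0, 1:] \<cdot>\<^sub>m 1\<^sub>m (pcard r n)"

definition in_smith_form :: "'a::comm_semiring_1 mat \<Rightarrow> bool" where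
  "in_smith_form B \<longleftrightarrow>
     (\<forall>i j. i < dim_row B \<and> j < dim_col B \<and> i \<noteq> j \<longrightarrow> B $$ (i, j) = 0) \<and>
     (\<forall>i. Suc i < min (dim_row B) (dim_col B) \<longrightarrow> B $$ (i, i) dvd B $$ (Suc i, Suc i))"

definition has_smith_form :: "'a::comm_semiring_1 mat \<Rightarrow> bool" where
  "has_smith_form A \<longleftrightarrow> (\<exists>P Q. P \<in> carrier_mat (dim_row A) (dim_row A) \<and>
     Q \<in> carrier_mat (dim_col A) (dim_col A) \<and> invertible_mat P \<and> invertible_mat Q \<and>
     in_smith_form (P * A * Q))"

definition int_vec_group :: "nat \<Rightarrow> int vec monoid" where
  "int_vec_group m = \<lparr>carrier = carrier_vec m, monoid.mult = (+), one = 0\<^sub>v m\<rparr>"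

definition coker :: "int mat \<Rightarrow> int vec set monoid" where
  "coker A = int_vec_group (dim_row A) Mod {A *\<^sub>v x | x. x \<in> carrier_vec (dim_col A)}"

text \<open>A (countable) group is free abelian iff it is isomorphic to a free abelian group on some set.\<close>
definition free_abelian :: "('a, 'b) monoid_scheme \<Rightarrow> bool" where
  "free_abelian G \<longleftrightarrow> (\<exists>S :: nat set. G \<cong> free_Abelian_group S)"

end

theory Submission
  imports Defs
begin

text \<open>
  A word of rank \<open>n + 1\<close> is \<open>1_i w\<close> with \<open>w\<close> of rank \<open>n\<close> or \<open>2 v\<close> with \<open>v\<close> of rank \<open>n - 1\<close>, and \<open>2 v\<close>
  covers \<open>w\<close> iff \<open>w\<close> covers \<open>v\<close>. Hence \<open>U x = (D x, x, \<dots>, x)\<close> with respect to this decomposition, and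
  dually \<open>D (x', x_1, \<dots>, x_r) = x_1 + \<dots> + x_r + U x'\<close>. The identity blocks make \<open>U\<close> split injective, so its cokernel is
  free. They also provide explicit coordinates in which \<open>DU + t = UD + (t + r)\<close> becomes the direct sum of
  an identity and a multiple of a map of the same kind of lower rank; the Smith form follows by
  induction on the rank. Vectors are functions on words with finite support, and linear maps are
  ordinary functions between them, so that a base change is a pair of mutually inverse functions.
\<close>

subsection \<open>Equivalence of linear maps on finitely supported functions\<close>

text \<open>Z[t] is not a principal ideal domain, so no general theorem supplies a Smith form: the
  base changes have to be written down together with their inverses. They use only ring operations,
  so they make sense over every commutative ring with an arbitrary element in the role of
  \<open>t\<close>. The induction consumes this generality, because each step replaces the parameter
  by a shifted one. Scalars are pulled out of nested blocks. Multiplying a map by a scalar, or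
  adding an identity block, preserves the property that any two diagonal entries are comparable
  under divisibility, so the entries never have to be computed. For r >= 2 they are 1 or of the form
  (t + r)(t + 2r)...(t + mr). The case r = 1 needs its own argument: one letter of value one is
  spent on splitting off the image of \<open>up\<close>, and it takes a second one to prescribe the
  value of \<open>down\<close> independently.\<close>

definition fsupp :: "'i set \<Rightarrow> ('i \<Rightarrow> 'a::zero) set" where
  "fsupp S = {x. \<forall>i. i \<notin> S \<longrightarrow> x i = 0}"

lemma fsuppD: "x \<in> fsupp S \<Longrightarrow> i \<notin> S \<Longrightarrow> x i = 0"
  by (simp add: fsupp_def)

lemma fsuppI: "(\<And>i. i \<notin> S \<Longrightarrow> x i = 0) \<Longrightarrow> x \<in> fsupp S"
  by (simp add: fsupp_def)

lemma fsupp_0: "x \<in> fsupp {} \<longleftrightarrow> x = (\<lambda>_. 0)"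
  by (auto simp: fsupp_def)

lemma fsupp_mono: "S \<subseteq> T \<Longrightarrow> x \<in> fsupp S \<Longrightarrow> x \<in> fsupp T"
  by (auto simp: fsupp_def)

lemma fsupp_add: "x \<in> fsupp S \<Longrightarrow> y \<in> fsupp S \<Longrightarrow> (\<lambda>i. x i + y i) \<in> fsupp S"
  and fsupp_diff: "x \<in> fsupp S \<Longrightarrow> y \<in> fsupp S \<Longrightarrow> (\<lambda>i. x i - y i) \<in> fsupp S"
  and fsupp_minus: "x \<in> fsupp S \<Longrightarrow> (\<lambda>i. - x i) \<in> fsupp S"
  and fsupp_mult: "x \<in> fsupp S \<Longrightarrow> (\<lambda>i. c * x i) \<in> fsupp S"
  for x y :: "'i \<Rightarrow> 'a::comm_ring_1"
  by (auto simp: fsupp_def)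

definition linear_form :: "(('i \<Rightarrow> 'a::comm_ring_1) \<Rightarrow> 'a) \<Rightarrow> bool" where
  "linear_form F \<longleftrightarrow> (\<forall>x y. F (\<lambda>i. x i + y i) = F x + F y) \<and> (\<forall>c x. F (\<lambda>i. c * x i) = c * F x)"

text \<open>Linearity is asked for on all functions, not only on those in some
  \<open>fsupp S\<close>, so its consequences carry no support conditions. The coordinatewise form
  lets compound maps be treated by the structural rules \<open>lin_intros\<close>.\<close>

definition linear_fun :: "(('i \<Rightarrow> 'a::comm_ring_1) \<Rightarrow> 'j \<Rightarrow> 'a) \<Rightarrow> bool" where
  "linear_fun f \<longleftrightarrow> (\<forall>j. linear_form (\<lambda>x. f x j))"

named_theorems lin_intros

lemma linear_form_proj [lin_intros]: "linear_form (\<lambda>x. x i)"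
  by (simp add: linear_form_def)

lemma linear_form_zero [lin_intros]: "linear_form (\<lambda>x. 0)"
  by (simp add: linear_form_def)

lemma linear_form_add [lin_intros]:
  "linear_form F \<Longrightarrow> linear_form G \<Longrightarrow> linear_form (\<lambda>x. F x + G x)"
  by (simp add: linear_form_def algebra_simps)

lemma linear_form_diff [lin_intros]:
  "linear_form F \<Longrightarrow> linear_form G \<Longrightarrow> linear_form (\<lambda>x. F x - G x)"
  by (simp add: linear_form_def algebra_simps)

lemma linear_form_minus [lin_intros]: "linear_form F \<Longrightarrow> linear_form (\<lambda>x. - F x)"
  by (simp add: linear_form_def algebra_simps)

lemma linear_form_mult [lin_intros]: "linear_form F \<Longrightarrow> linear_form (\<lambda>x. c * F x)"
  by (simp add: linear_form_def algebra_simps)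

lemma linear_form_sum [lin_intros]:
  "(\<And>k. k \<in> K \<Longrightarrow> linear_form (F k)) \<Longrightarrow> linear_form (\<lambda>x. \<Sum>k\<in>K. F k x)"
  by (simp add: linear_form_def sum.distrib sum_distrib_left)

lemma linear_form_if [lin_intros]:
  "linear_form F \<Longrightarrow> linear_form G \<Longrightarrow> linear_form (\<lambda>x. if b then F x else G x)"
  by (cases b) auto

lemma linear_form_case_sum [lin_intros]:
  assumes "\<And>i. linear_form (\<lambda>x. f x i)" "\<And>i. linear_form (\<lambda>x. g x i)"
  shows "linear_form (\<lambda>x. case_sum (f x) (g x) j)"
  using assms by (cases j) auto

lemma linear_funI: "(\<And>j. linear_form (\<lambda>x. f x j)) \<Longrightarrow> linear_fun f"
  by (simp add: linear_fun_def)

lemma linear_form_compose: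
  assumes "linear_fun f" "\<And>i. linear_form (\<lambda>x. g x i)"
  shows "linear_form (\<lambda>x. f (\<lambda>i. g x i) j)"
proof -
  have "g (\<lambda>i. x i + y i) = (\<lambda>i. g x i + g y i)" "g (\<lambda>i. c * x i) = (\<lambda>i. c * g x i)" for x y c
    using assms(2) by (auto simp: linear_form_def)
  then show ?thesis
    using assms(1) by (simp add: linear_fun_def linear_form_def)
qed

lemma linear_fun_compose:
  assumes "linear_fun f" "linear_fun g"
  shows "linear_fun (\<lambda>x. f (g x))"
  using linear_form_compose[OF assms(1), of g] assms(2) unfolding linear_fun_def by blast

lemma linear_fun_add: "linear_fun f \<Longrightarrow> f (\<lambda>i. x i + y i) = (\<lambda>j. f x j + f y j)"
  and linear_fun_mult: "linear_fun f \<Longrightarrow> f (\<lambda>i. c * x i) = (\<lambda>j. c * f x j)"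
  by (auto simp: linear_fun_def linear_form_def)

lemma linear_fun_zero: "linear_fun f \<Longrightarrow> f (\<lambda>i. 0) = (\<lambda>j. 0)"
  using linear_fun_mult[of f 0 "\<lambda>i. 0"] by simp

lemma linear_fun_minus: "linear_fun f \<Longrightarrow> f (\<lambda>i. - x i) = (\<lambda>j. - f x j)"
  using linear_fun_mult[of f "- 1" x] by simp

lemma linear_fun_diff: "linear_fun f \<Longrightarrow> f (\<lambda>i. x i - y i) = (\<lambda>j. f x j - f y j)"
  using linear_fun_add[of f x "\<lambda>i. - y i"] linear_fun_minus[of f y] by simp

lemma linear_fun_sum:
  assumes "linear_fun f"
  shows "f (\<lambda>i. \<Sum>k\<in>K. x k i) = (\<lambda>j. \<Sum>k\<in>K. f (x k) j)"
  by (induction K rule: infinite_finite_induct)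
    (simp_all add: linear_fun_zero[OF assms] linear_fun_add[OF assms])

section \<open>Equivalence of maps and diagonal forms\<close>

definition lin_iso :: "'i set \<Rightarrow> 'j set \<Rightarrow> (('i \<Rightarrow> 'a::comm_ring_1) \<Rightarrow> 'j \<Rightarrow> 'a)
    \<Rightarrow> (('j \<Rightarrow> 'a) \<Rightarrow> 'i \<Rightarrow> 'a) \<Rightarrow> bool" where
  "lin_iso S T f g \<longleftrightarrow> linear_fun f \<and> linear_fun g \<and>
     (\<forall>x\<in>fsupp S. f x \<in> fsupp T \<and> g (f x) = x) \<and> (\<forall>y\<in>fsupp T. g y \<in> fsupp S \<and> f (g y) = y)"

text \<open>This is equivalence of matrices, not similarity: source and target are changed by
  independent isomorphisms. The equal cardinalities later allow a diagonal on \<open>T\<close> to be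
  carried back to \<open>S\<close> by a bijection.\<close>

definition lin_equiv :: "'i set \<Rightarrow> (('i \<Rightarrow> 'a::comm_ring_1) \<Rightarrow> 'i \<Rightarrow> 'a)
    \<Rightarrow> 'j set \<Rightarrow> (('j \<Rightarrow> 'a) \<Rightarrow> 'j \<Rightarrow> 'a) \<Rightarrow> bool" where
  "lin_equiv S f T g \<longleftrightarrow> finite S \<and> finite T \<and> card S = card T \<and>
     (\<exists>\<phi> \<phi>' \<psi> \<psi>'. lin_iso S T \<phi> \<phi>' \<and> lin_iso S T \<psi> \<psi>' \<and> (\<forall>x\<in>fsupp S. \<psi> (f x) = g (\<phi> x)))"

text \<open>Index sets carry no order, so the divisibility chain is encoded as pairwise
  comparability; sorting is postponed to the passage to matrices.\<close>

definition smith :: "'i set \<Rightarrow> (('i \<Rightarrow> 'a::comm_ring_1) \<Rightarrow> 'i \<Rightarrow> 'a) \<Rightarrow> bool" where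
  "smith S f \<longleftrightarrow> (\<exists>d. (\<forall>i\<in>S. \<forall>j\<in>S. d i dvd d j \<or> d j dvd d i) \<and>
     lin_equiv S f S (\<lambda>x i. d i * x i))"

lemma lin_equivI:
  assumes "finite S" "finite T" "card S = card T" "lin_iso S T \<phi> \<phi>'" "lin_iso S T \<psi> \<psi>'"
    "\<And>x. x \<in> fsupp S \<Longrightarrow> \<psi> (f x) = g (\<phi> x)"
  shows "lin_equiv S f T g"
  unfolding lin_equiv_def using assms by blast

lemma smithI:
  assumes "lin_equiv S f S (\<lambda>x i. d i * x i)" "\<And>i j. i \<in> S \<Longrightarrow> j \<in> S \<Longrightarrow> d i dvd d j \<or> d j dvd d i"
  shows "smith S f"
  unfolding smith_def using assms by blast

lemma lin_iso_trans:
  assumes "lin_iso S T f f'" "lin_iso T R g g'"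
  shows "lin_iso S R (\<lambda>x. g (f x)) (\<lambda>x. f' (g' x))"
proof -
  have "linear_fun (\<lambda>x. g (f x))" "linear_fun (\<lambda>x. f' (g' x))"
    using assms linear_fun_compose[of g f] linear_fun_compose[of f' g'] by (simp_all add: lin_iso_def)
  then show ?thesis
    using assms by (simp add: lin_iso_def)
qed

lemma lin_equiv_trans:
  assumes "lin_equiv S f T g" "lin_equiv T g R h"
  shows "lin_equiv S f R h"
proof -
  obtain \<phi> \<phi>' \<psi> \<psi>' where 1: "lin_iso S T \<phi> \<phi>'" "lin_iso S T \<psi> \<psi>'"
    and 2: "\<And>x. x \<in> fsupp S \<Longrightarrow> \<psi> (f x) = g (\<phi> x)"
    using assms(1) by (auto simp: lin_equiv_def)
  obtain \<alpha> \<alpha>' \<beta> \<beta>' where 3: "lin_iso T R \<alpha> \<alpha>'" "lin_iso T R \<beta> \<beta>'"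
    and 4: "\<And>x. x \<in> fsupp T \<Longrightarrow> \<beta> (g x) = h (\<alpha> x)"
    using assms(2) by (auto simp: lin_equiv_def)
  have "\<forall>x\<in>fsupp S. \<beta> (\<psi> (f x)) = h (\<alpha> (\<phi> x))"
    using 2 4 1 by (auto simp: lin_iso_def)
  moreover have "lin_iso S R (\<lambda>x. \<alpha> (\<phi> x)) (\<lambda>x. \<phi>' (\<alpha>' x))" "lin_iso S R (\<lambda>x. \<beta> (\<psi> x)) (\<lambda>x. \<psi>' (\<beta>' x))"
    using 1 3 lin_iso_trans by blast+
  moreover have "finite S" "finite R" "card S = card R"
    using assms by (auto simp: lin_equiv_def)
  ultimately show ?thesis
    unfolding lin_equiv_def by blast
qed

lemma lin_iso_reindex:
  fixes h :: "'i \<Rightarrow> 'j"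
  assumes "bij_betw h S T"
  shows "lin_iso T S (\<lambda>x i. if i \<in> S then x (h i) else (0::'a::comm_ring_1))
           (\<lambda>y j. if j \<in> T then y (the_inv_into S h j) else 0)"
proof -
  have inj: "inj_on h S" and im: "h ` S = T"
    using assms by (auto simp: bij_betw_def)
  have "linear_fun (\<lambda>x i. if i \<in> S then x (h i) else (0::'a))"
    "linear_fun (\<lambda>y j. if j \<in> T then y (the_inv_into S h j) else (0::'a))"
    by (intro linear_funI lin_intros)+
  moreover have "the_inv_into S h (h i) = i" "h i \<in> T" if "i \<in> S" for i
    using that the_inv_into_f_f[OF inj] im by auto
  moreover have "h (the_inv_into S h j) = j" "the_inv_into S h j \<in> S" if "j \<in> T" for j
    using that f_the_inv_into_f[OF inj] the_inv_into_into[OF inj _ subset_refl] im by auto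
  ultimately show ?thesis
    unfolding lin_iso_def fsupp_def by (simp add: fun_eq_iff)
qed

text \<open>The diagonal found on \<open>T\<close> lives on the wrong index set; relabelling along a
  bijection from \<open>S\<close> to \<open>T\<close> turns it into a diagonal on \<open>S\<close>
  with the same entries.\<close>

lemma smith_lin_equiv:
  assumes "lin_equiv S f T g" "smith T g"
  shows "smith S f"
proof -
  obtain d where d: "\<forall>i\<in>T. \<forall>j\<in>T. d i dvd d j \<or> d j dvd d i"
    and e: "lin_equiv T g T (\<lambda>x i. d i * x i)"
    using assms(2) by (auto simp: smith_def)
  have fin: "finite S" "finite T" "card S = card T"
    using assms by (auto simp: lin_equiv_def)
  then obtain h where h: "bij_betw h S T"
    using finite_same_card_bij by blast
  have "lin_equiv T (\<lambda>x i. d i * x i) S (\<lambda>x i. d (h i) * x i)"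
    using fin by (intro lin_equivI[OF _ _ _ lin_iso_reindex[OF h] lin_iso_reindex[OF h]])
      (auto simp: fun_eq_iff fsupp_def)
  then have "lin_equiv S f S (\<lambda>x i. d (h i) * x i)"
    by (rule lin_equiv_trans[OF lin_equiv_trans[OF assms(1) e]])
  moreover have "\<forall>i\<in>S. \<forall>j\<in>S. d (h i) dvd d (h j) \<or> d (h j) dvd d (h i)"
    using d h by (auto simp: bij_betw_def)
  ultimately show ?thesis
    by (intro smithI[where d="\<lambda>i. d (h i)"]) simp_all
qed

lemma lin_iso_id: "lin_iso S S (\<lambda>x. x) (\<lambda>x. x)"
  unfolding lin_iso_def by (intro conjI linear_funI lin_intros) simp_all

lemma smith_diagonal:
  assumes "finite S" "\<And>x i. x \<in> fsupp S \<Longrightarrow> f x i = c * x i"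
  shows "smith S f"
  by (rule smithI[where d="\<lambda>_. c"], rule lin_equivI[OF _ _ _ lin_iso_id lin_iso_id])
    (use assms in \<open>simp_all add: fun_eq_iff\<close>)

lemma smith_mult:
  assumes "smith S f"
  shows "smith S (\<lambda>x j. s * f x j)"
proof -
  obtain d \<phi> \<phi>' \<psi> \<psi>' where d: "\<forall>i\<in>S. \<forall>j\<in>S. d i dvd d j \<or> d j dvd d i"
    and e: "finite S" "lin_iso S S \<phi> \<phi>'" "lin_iso S S \<psi> \<psi>'" "\<forall>x\<in>fsupp S. \<psi> (f x) = (\<lambda>i. d i * \<phi> x i)"
    using assms by (auto simp: smith_def lin_equiv_def)
  have "linear_fun \<psi>"
    using e by (simp add: lin_iso_def)
  then have "\<forall>x\<in>fsupp S. \<psi> (\<lambda>j. s * f x j) = (\<lambda>i. (s * d i) * \<phi> x i)"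
    using e(4) linear_fun_mult[of \<psi> s] by (simp add: mult.assoc)
  moreover have "\<forall>i\<in>S. \<forall>j\<in>S. s * d i dvd s * d j \<or> s * d j dvd s * d i"
    using d by (meson dvd_refl mult_dvd_mono)
  ultimately show ?thesis
    by (intro smithI[where d="\<lambda>i. s * d i"] lin_equivI[OF e(1) e(1) refl e(2,3)]) simp_all
qed

section \<open>Direct sums with an identity map\<close>

lemma fsupp_case_sum [simp]:
  "case_sum x y \<in> fsupp (A <+> B) \<longleftrightarrow> x \<in> fsupp A \<and> y \<in> fsupp B"
proof
  assume *: "case_sum x y \<in> fsupp (A <+> B)"
  have "x i = 0" if "i \<notin> A" for i
    using * that by (auto simp: fsupp_def dest: spec[of _ "Inl i"])
  moreover have "y i = 0" if "i \<notin> B" for i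
    using * that by (auto simp: fsupp_def dest: spec[of _ "Inr i"])
  ultimately show "x \<in> fsupp A \<and> y \<in> fsupp B"
    by (simp add: fsupp_def)
next
  assume "x \<in> fsupp A \<and> y \<in> fsupp B"
  then have "case_sum x y j = 0" if "j \<notin> A <+> B" for j
    using that by (cases j) (auto simp: fsupp_def)
  then show "case_sum x y \<in> fsupp (A <+> B)"
    by (simp add: fsupp_def)
qed

lemma fsupp_Plus_cases:
  assumes "z \<in> fsupp (A <+> B)"
  obtains x y where "z = case_sum x y" "x \<in> fsupp A" "y \<in> fsupp B"
proof (rule that)
  show z: "z = case_sum (\<lambda>i. z (Inl i)) (\<lambda>i. z (Inr i))"
    by (simp add: fun_eq_iff split: sum.split)
  show "(\<lambda>i. z (Inl i)) \<in> fsupp A" "(\<lambda>i. z (Inr i)) \<in> fsupp B"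
    using assms by (subst (asm) z, simp)+
qed

lemma lin_iso_Plus_id:
  assumes "lin_iso S T f g"
  shows "lin_iso (A <+> S) (A <+> T) (\<lambda>x. case_sum (\<lambda>i. x (Inl i)) (f (\<lambda>j. x (Inr j))))
     (\<lambda>x. case_sum (\<lambda>i. x (Inl i)) (g (\<lambda>j. x (Inr j))))"
proof -
  have f: "linear_fun f" and g: "linear_fun g"
    using assms by (auto simp: lin_iso_def)
  have "linear_fun (\<lambda>x. case_sum (\<lambda>i. x (Inl i)) (f (\<lambda>j. x (Inr j))))"
    by (intro linear_funI linear_form_case_sum linear_form_proj linear_form_compose[OF f])
  moreover have "linear_fun (\<lambda>x. case_sum (\<lambda>i. x (Inl i)) (g (\<lambda>j. x (Inr j))))"
    by (intro linear_funI linear_form_case_sum linear_form_proj linear_form_compose[OF g])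
  ultimately show ?thesis
    using assms unfolding lin_iso_def by (fastforce elim: fsupp_Plus_cases)
qed

lemma smith_Plus_id:
  fixes f :: "('j \<Rightarrow> 'a::comm_ring_1) \<Rightarrow> 'j \<Rightarrow> 'a" and A :: "'i set"
  assumes "finite A" "smith S f"
  shows "smith (A <+> S) (\<lambda>x. case_sum (\<lambda>i. x (Inl i)) (f (\<lambda>j. x (Inr j))))"
proof -
  obtain d \<phi> \<phi>' \<psi> \<psi>' where d: "\<forall>i\<in>S. \<forall>j\<in>S. d i dvd d j \<or> d j dvd d i"
    and e: "finite S" "lin_iso S S \<phi> \<phi>'" "lin_iso S S \<psi> \<psi>'" "\<forall>x\<in>fsupp S. \<psi> (f x) = (\<lambda>i. d i * \<phi> x i)"
    using assms by (auto simp: smith_def lin_equiv_def)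
  let ?d = "case_sum (\<lambda>_. 1) d"
  let ?h = "\<lambda>\<phi> x. case_sum (\<lambda>i. x (Inl i)) (\<phi> (\<lambda>j. x (Inr j)))"
  have "\<forall>x\<in>fsupp (A <+> S). ?h \<psi> (?h f x) = (\<lambda>i. ?d i * ?h \<phi> x i)"
  proof
    fix z :: "'i + 'j \<Rightarrow> 'a" assume "z \<in> fsupp (A <+> S)"
    then obtain x y where "z = case_sum x y" "y \<in> fsupp S"
      by (elim fsupp_Plus_cases)
    then show "?h \<psi> (?h f z) = (\<lambda>i. ?d i * ?h \<phi> z i)"
      using e(4) by (simp add: fun_eq_iff split: sum.split)
  qed
  moreover have "\<forall>i\<in>A <+> S. \<forall>j\<in>A <+> S. ?d i dvd ?d j \<or> ?d j dvd ?d i"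
  proof (intro ballI)
    fix i j assume "i \<in> A <+> S" "j \<in> A <+> S"
    then consider "?d i = 1" | "?d j = 1" | a b where "i = Inr a" "j = Inr b" "a \<in> S" "b \<in> S"
      by (elim PlusE) auto
    then show "?d i dvd ?d j \<or> ?d j dvd ?d i"
      by cases (use d in simp_all)
  qed
  moreover have "finite (A <+> S)"
    using assms(1) e(1) by simp
  ultimately show ?thesis
    by (intro smithI[where d="?d"] lin_equivI[OF _ _ refl lin_iso_Plus_id[OF e(2)] lin_iso_Plus_id[OF e(3)]])
      blast+
qed

subsection \<open>The up and down maps\<close>

text \<open>Recursion on the word at which the result is evaluated: for valid \<open>w\<close>,
  \<open>up r x w\<close> sums \<open>x\<close> over the words covered by \<open>w\<close>. A word
  \<open>Two # w\<close> covers the words \<open>One i # w\<close>, and \<open>Two # v\<close>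
  whenever \<open>w\<close> covers \<open>v\<close>.\<close>

fun up :: "nat \<Rightarrow> (letter list \<Rightarrow> 'a::comm_ring_1) \<Rightarrow> letter list \<Rightarrow> 'a" where
  "up r x [] = 0"
| "up r x (One i # w) = (if 1 \<le> i \<and> i \<le> r then x w else 0)"
| "up r x (Two # w) = (\<Sum>i=1..r. x (One i # w)) + up r (\<lambda>v. x (Two # v)) w"

text \<open>The right-hand side is literally that of \<open>up\<close> at \<open>Two # w\<close>.
  That this is the transpose of \<open>up\<close> is established only later, in
  \<open>down_unit_fun\<close>.\<close>

definition down :: "nat \<Rightarrow> (letter list \<Rightarrow> 'a::comm_ring_1) \<Rightarrow> letter list \<Rightarrow> 'a" where
  "down r x w = (\<Sum>i=1..r. x (One i # w)) + up r (\<lambda>v. x (Two # v)) w"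

lemma up_Two: "up r x (Two # w) = down r x w"
  by (simp add: down_def)

declare up.simps(3) [simp del] up_Two [simp]

lemma linear_fun_up: "linear_fun (up r)"
proof (rule linear_funI)
  show "linear_form (\<lambda>x :: letter list \<Rightarrow> 'a. up r x w)" for w
  \<comment> \<open>The vector is bound inside the claim, so the vector argument of the rule is
    filled with the zero function, which stays zero when a leading \<open>Two\<close> is split
    off.\<close>
  proof (induction r "\<lambda>_ :: letter list. 0 :: 'a" w rule: up.induct)
    case (3 r w)
    have "linear_form (\<lambda>x :: letter list \<Rightarrow> 'a. up r (\<lambda>v. x (Two # v)) w)"
      using 3 by (simp add: linear_form_def)
    then show ?case
      unfolding up.simps by (intro lin_intros)
  qed (auto simp: linear_form_def)
qed

lemma linear_fun_down: "linear_fun (down r)"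
proof (rule linear_funI)
  show "linear_form (\<lambda>x :: letter list \<Rightarrow> 'a. down r x w)" for w
    unfolding down_def by (intro lin_intros linear_form_compose[OF linear_fun_up])
qed

lemmas up_linear = linear_fun_add[OF linear_fun_up] linear_fun_diff[OF linear_fun_up]
  linear_fun_mult[OF linear_fun_up] linear_fun_minus[OF linear_fun_up] linear_fun_zero[OF linear_fun_up]

lemmas down_linear = linear_fun_add[OF linear_fun_down] linear_fun_diff[OF linear_fun_down]
  linear_fun_mult[OF linear_fun_down] linear_fun_minus[OF linear_fun_down] linear_fun_zero[OF linear_fun_down]

text \<open>The defining relation DU - UD = r of a differential poset: \<open>up r x\<close> takes
  the value \<open>x w\<close> at each of the r words \<open>One i # w\<close>, and its restriction
  to the words \<open>Two # v\<close> is \<open>down r x\<close>.\<close>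

lemma down_up: "down r (up r x) = (\<lambda>w. of_nat r * x w + up r (down r x) w)"
  by (simp add: fun_eq_iff down_def[of r "up r x"])

text \<open>The words of rank \<open>k - 1\<close>; the shift makes room for the empty set of words of rank \<open>- 1\<close>.\<close>
definition words :: "nat \<Rightarrow> nat \<Rightarrow> letter list set" where
  "words r k = {w. valid_word r w \<and> Suc (word_rank w) = k}"

lemma words_0 [simp]: "words r 0 = {}"
  and words_Suc: "words r (Suc n) = Pset r n"
  by (auto simp: words_def Pset_def)

lemma valid_word_simps [simp]:
  "valid_word r []"
  "valid_word r (One i # w) \<longleftrightarrow> 1 \<le> i \<and> i \<le> r \<and> valid_word r w"
  "valid_word r (Two # w) \<longleftrightarrow> valid_word r w"
  by (auto simp: valid_word_def)

lemma word_rank_simps [simp]: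
  "word_rank [] = 0" "word_rank (One i # w) = Suc (word_rank w)"
  "word_rank (Two # w) = Suc (Suc (word_rank w))"
  by (auto simp: word_rank_def)

text \<open>The truncated \<open>k - 1\<close> is correct at \<open>k = 0\<close> because
  \<open>words r 0\<close> is empty.\<close>

lemma in_words [simp]:
  "[] \<in> words r k \<longleftrightarrow> k = 1"
  "One i # w \<in> words r (Suc k) \<longleftrightarrow> 1 \<le> i \<and> i \<le> r \<and> w \<in> words r k"
  "Two # w \<in> words r (Suc k) \<longleftrightarrow> w \<in> words r (k - 1)"
  by (auto simp: words_def)

lemma word_cases:
  obtains "w = []" | i v where "w = One i # v" | v where "w = Two # v"
  by (metis letter.exhaust list.exhaust)

lemma words_1 [simp]: "words r (Suc 0) = {[]}"
proof -
  have "w \<in> words r (Suc 0) \<longleftrightarrow> w = []" for w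
    by (cases w rule: word_cases) auto
  then show ?thesis by auto
qed

lemma words_Suc_Suc:
  "words r (Suc (Suc k)) = (#) Two ` words r k \<union> (\<Union>i\<in>{1..r}. (#) (One i) ` words r (Suc k))"
proof -
  have "w \<in> words r (Suc (Suc k)) \<longleftrightarrow>
      w \<in> (#) Two ` words r k \<union> (\<Union>i\<in>{1..r}. (#) (One i) ` words r (Suc k))" for w
    by (cases w rule: word_cases) auto
  then show ?thesis by auto
qed

lemma finite_words [simp]: "finite (words r k)"
proof (induction k rule: induct_nat_012)
  case (ge2 k)
  then show ?case by (simp add: words_Suc_Suc)
qed auto

lemma card_words_Suc_Suc:
  "card (words r (Suc (Suc k))) = card (words r k) + r * card (words r (Suc k))"
proof -
  have "card (\<Union>i\<in>{1..r}. (#) (One i) ` words r (Suc k)) = r * card (words r (Suc k))"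
    by (subst card_UN_disjoint) (auto simp: card_image)
  moreover have "card ((#) Two ` words r k) = card (words r k)"
    by (simp add: card_image)
  ultimately show ?thesis
    unfolding words_Suc_Suc by (subst card_Un_disjoint) auto
qed

lemma fsupp_One: "x \<in> fsupp (words r (Suc k)) \<Longrightarrow> (\<lambda>w. x (One i # w)) \<in> fsupp (words r k)"
  by (auto intro!: fsuppI elim!: fsuppD)

lemma fsupp_Two: "x \<in> fsupp (words r (Suc k)) \<Longrightarrow> (\<lambda>w. x (Two # w)) \<in> fsupp (words r (k - 1))"
  by (auto intro!: fsuppI elim!: fsuppD)

lemma fsupp_up: "x \<in> fsupp (words r k) \<Longrightarrow> up r x \<in> fsupp (words r (Suc k))"
proof (rule fsuppI)
  show "x \<in> fsupp (words r k) \<Longrightarrow> w \<notin> words r (Suc k) \<Longrightarrow> up r x w = 0" for w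
  proof (induction r x w arbitrary: k rule: up.induct)
    case (2 r x i w)
    then show ?case by (auto dest: fsuppD)
  next
    case (3 r x w)
    show ?case
    proof (cases k)
      case 0
      then show ?thesis using 3 by (simp add: fsupp_0 linear_fun_zero[OF linear_fun_down])
    next
      case (Suc k')
      have "up r (\<lambda>v. x (Two # v)) w = 0"
      proof (cases k')
        case 0
        then show ?thesis using fsupp_Two[of x r k'] 3 Suc by (simp add: fsupp_0 linear_fun_zero[OF linear_fun_up])
      next
        case (Suc j)
        then show ?thesis
          using 3 \<open>k = Suc k'\<close> fsupp_Two[of x r k'] by (intro "3.IH"[of "k' - 1"]) auto
      qed
      moreover have "x (One i # w) = 0" for i
        using 3 Suc by (auto dest!: fsuppD[of x _ "One i # w"])
      ultimately show ?thesis by (simp add: down_def)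
    qed
  qed auto
qed

text \<open>\<open>down r x\<close> is the part of \<open>up r x\<close> on words beginning with
  \<open>Two\<close>: the rank rises by one and then drops by two.\<close>

lemma fsupp_down: "x \<in> fsupp (words r (Suc k)) \<Longrightarrow> down r x \<in> fsupp (words r k)"
  using fsupp_Two[OF fsupp_up, of x r "Suc k"] by simp

subsection \<open>Reduction of the Smith form for at least two letters of value one\<close>

fun prepend :: "letter \<Rightarrow> (letter list \<Rightarrow> 'a::comm_ring_1) \<Rightarrow> letter list \<Rightarrow> 'a" where
  "prepend a x [] = 0"
| "prepend a x (b # v) = (if b = a then x v else 0)"

lemma linear_fun_prepend: "linear_fun (prepend a)"
proof (rule linear_funI)
  show "linear_form (\<lambda>x :: letter list \<Rightarrow> 'a. prepend a x w)" for w
    by (cases w) (simp_all add: linear_form_def)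
qed

lemmas word_lin_intros = lin_intros linear_form_compose[OF linear_fun_up]
  linear_form_compose[OF linear_fun_down] linear_form_compose[OF linear_fun_prepend]

text \<open>A right inverse of \<open>down\<close>. Adding a vector \<open>prepend (One i) u\<close>
  changes \<open>down\<close> by exactly \<open>u\<close> and affects only words beginning with
  \<open>One i\<close>.\<close>

lemma down_prepend_One:
  assumes "1 \<le> i" "i \<le> r"
  shows "down r (prepend (One i) x) = x"
proof -
  have "(\<Sum>j=1..r. if j = i then x w else 0) = x w" for w
    using assms by simp
  then show ?thesis
    by (simp add: fun_eq_iff down_def up_linear)
qed

lemma down_prepend_Two: "down r (prepend Two x) = up r x"
  by (simp add: fun_eq_iff down_def)

lemma fsupp_prepend_One:
  assumes "1 \<le> i" "i \<le> r" "x \<in> fsupp (words r k)"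
  shows "prepend (One i) x \<in> fsupp (words r (Suc k))"
proof (rule fsuppI)
  show "prepend (One i) x w = 0" if "w \<notin> words r (Suc k)" for w
    using that assms by (cases w rule: word_cases) (auto dest: fsuppD)
qed

lemma fsupp_prepend_Two:
  assumes "x \<in> fsupp (words r k)"
  shows "prepend Two x \<in> fsupp (words r (Suc (Suc k)))"
proof (rule fsuppI)
  show "prepend Two x w = 0" if "w \<notin> words r (Suc (Suc k))" for w
    using that assms by (cases w rule: word_cases) (auto dest: fsuppD)
qed

text \<open>In rank 0 the down map vanishes, so DU is multiplication by r.\<close>

lemma smith_down_up_0:
  fixes t :: "'a::comm_ring_1"
  shows "smith (words r (Suc 0)) (\<lambda>x w. down r (up r x) w + t * x w)"
proof (rule smith_diagonal[where c = "of_nat r + t"])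
  fix x :: "letter list \<Rightarrow> 'a" and w assume "x \<in> fsupp (words r (Suc 0))"
  then have "down r x = (\<lambda>_. 0)"
    using fsupp_down[of x r 0] by (simp add: fsupp_0)
  then show "down r (up r x) w + t * x w = (of_nat r + t) * x w"
    by (simp add: down_up up_linear algebra_simps)
qed simp

text \<open>With \<open>x\<^sub>1 v = x (One 1 # v)\<close>, the difference \<open>x - up r x\<^sub>1\<close> vanishes on all words \<open>One 1 # v\<close>;
  \<open>other_part\<close> is its restriction to the words that start with neither \<open>One 1\<close> nor \<open>One 2\<close>.\<close>
definition other_words :: "nat \<Rightarrow> nat \<Rightarrow> letter list set" where
  "other_words r k = {w \<in> words r k. \<forall>v. w \<noteq> One 1 # v \<and> w \<noteq> One 2 # v}"

definition other_part :: "nat \<Rightarrow> nat \<Rightarrow> (letter list \<Rightarrow> 'a::comm_ring_1) \<Rightarrow> letter list \<Rightarrow> 'a" where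
  "other_part r k x w = (if w \<in> other_words r k then x w - up r (\<lambda>v. x (One 1 # v)) w else 0)"

lemma linear_fun_other_part: "linear_fun (other_part r k)"
  unfolding other_part_def
  by (intro linear_funI lin_intros linear_form_compose[OF linear_fun_up])

lemma fsupp_other_part: "other_part r k x \<in> fsupp (other_words r k)"
  by (simp add: fsupp_def other_part_def)

lemma other_words_simps [simp]:
  "One 1 # w \<notin> other_words r k" "One (Suc 0) # w \<notin> other_words r k" "One 2 # w \<notin> other_words r k"
  by (auto simp: other_words_def)

text \<open>A vector is determined by its \<open>One 1\<close> coordinate, its
  \<open>other_part\<close> and its image under \<open>down\<close>. After the first two have been
  accounted for, the remainder is supported on words \<open>One 2 # v\<close>, where
  \<open>down\<close> reads it off.\<close>

lemma decompose_word_vector: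
  fixes x :: "letter list \<Rightarrow> 'a::comm_ring_1"
  assumes "r \<ge> 2" "x \<in> fsupp (words r (Suc k))"
  defines "y \<equiv> up r (\<lambda>v. x (One 1 # v))" and "z \<equiv> other_part r (Suc k) x"
  shows "(\<lambda>w. y w + z w + prepend (One 2) (\<lambda>w. down r x w - down r y w - down r z w) w) = x"
proof -
  let ?u = "\<lambda>w. x (One 2 # w) - y (One 2 # w)"
  have eq: "x = (\<lambda>w. y w + z w + prepend (One 2) ?u w)"
  proof
    fix w
    show "x w = y w + z w + prepend (One 2) ?u w"
    proof (cases "w \<in> other_words r (Suc k)")
      case True
      then have "prepend (One 2) ?u w = 0"
        by (cases w) (auto simp: other_words_def)
      with True show ?thesis by (simp add: z_def y_def other_part_def)
    next
      case False
      then have z: "z w = 0" by (simp add: z_def other_part_def)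
      consider v where "w = One 1 # v" | v where "w = One 2 # v" | "w \<notin> words r (Suc k)" "\<forall>v. w \<noteq> One 2 # v"
        using False by (auto simp: other_words_def)
      then show ?thesis
      proof cases
        case 3
        have "y \<in> fsupp (words r (Suc k))"
          unfolding y_def using fsupp_up fsupp_One assms(2) by blast
        then have "y w = 0" "x w = 0"
          using 3 assms(2) by (auto dest: fsuppD)
        moreover have "prepend (One 2) ?u w = 0"
          using 3(2) by (cases w) auto
        ultimately show ?thesis using z by simp
      qed (use z assms(1) in \<open>auto simp: y_def\<close>)
    qed
  qed
  have "down r x = (\<lambda>w. down r y w + down r z w + ?u w)"
    by (subst eq) (use assms(1) in \<open>simp add: down_linear down_prepend_One\<close>)
  then show ?thesis
    using eq by simp
qed

lemma card_other_words:
  assumes "r \<ge> 2"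
  shows "card (words r (Suc (Suc n))) = card (words r (Suc n)) + (card (other_words r (Suc (Suc n))) + card (words r (Suc n)))"
proof -
  let ?W = "words r (Suc n)" and ?C = "other_words r (Suc (Suc n))"
  have "words r (Suc (Suc n)) = (#) (One 1) ` ?W \<union> (?C \<union> (#) (One 2) ` ?W)"
    using assms by (auto simp: other_words_def)
  moreover have "card ((#) (One 1) ` ?W \<union> (?C \<union> (#) (One 2) ` ?W)) = card ?W + (card ?C + card ?W)"
    by (subst card_Un_disjoint; (subst card_Un_disjoint)?) (auto simp: card_image other_words_def)
  ultimately show ?thesis by simp
qed

text \<open>Write \<open>s = t + r\<close>, so that the map in question is \<open>f = up \<circ> down + s\<close>.
  The coordinates \<open>(down x + s x\<^sub>1, other_part x, x\<^sub>1)\<close> of the source and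
  \<open>(y\<^sub>1, other_part y, down (up y\<^sub>1) + s y\<^sub>1 - down y)\<close> of the target turn \<open>f\<close> into
  \<open>id \<oplus> s (id \<oplus> (down \<circ> up + s))\<close>, where the last summand lives one rank lower.\<close>
lemma smith_down_up_ge_2:
  fixes t :: "'a::comm_ring_1"
  assumes "r \<ge> 2"
  shows "smith (words r (Suc n)) (\<lambda>x w. down r (up r x) w + t * x w)"
proof (induction n arbitrary: t)
  case 0
  show ?case by (rule smith_down_up_0)
next
  case (Suc n)
  let ?S = "words r (Suc (Suc n))" and ?W = "words r (Suc n)" and ?C = "other_words r (Suc (Suc n))"
  let ?q = "other_part r (Suc (Suc n))"
  define s where "s = t + of_nat r"
  define f where "f = (\<lambda>(x :: letter list \<Rightarrow> 'a) w. down r (up r x) w + t * x w)"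
  define N where "N = (\<lambda>(x :: letter list \<Rightarrow> 'a) w. down r (up r x) w + s * x w)"
  define h where "h = (\<lambda>z :: letter list + letter list \<Rightarrow> 'a. case_sum (\<lambda>i. z (Inl i)) (N (\<lambda>j. z (Inr j))))"
  define g where "g = (\<lambda>z :: letter list + letter list + letter list \<Rightarrow> 'a.
    case_sum (\<lambda>i. z (Inl i)) ((\<lambda>y j. s * h y j) (\<lambda>j. z (Inr j))))"
  define \<phi> where "\<phi> = (\<lambda>x. case_sum (\<lambda>w. down r x w + s * x (One 1 # w)) (case_sum (?q x) (\<lambda>w. x (One 1 # w))))"
  \<comment> \<open>From components a, c, b the vector is rebuilt as \<open>up r b + c\<close>,
    which has \<open>One 1\<close> coordinate b; the term in \<open>One 2\<close> then corrects the
    value of \<open>down\<close> to a - s b.\<close>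
  define \<phi>' where "\<phi>' = (\<lambda>(z :: letter list + letter list + letter list \<Rightarrow> 'a) w.
    up r (\<lambda>v. z (Inr (Inr v))) w + z (Inr (Inl w)) +
      prepend (One 2) (\<lambda>w. z (Inl w) - s * z (Inr (Inr w)) - down r (\<lambda>w. up r (\<lambda>v. z (Inr (Inr v))) w) w
         - down r (\<lambda>v. z (Inr (Inl v))) w) w)"
  \<comment> \<open>For y = UDx + sx one has y1 = Dx + s x1 and Dy = DU(Dx) + s Dx. In DU y1 + s y1
    - Dy all terms in Dx cancel, leaving s (DU x1 + s x1).\<close>
  define \<psi> where "\<psi> = (\<lambda>y. case_sum (\<lambda>w. y (One 1 # w)) (case_sum (?q y)
    (\<lambda>w. down r (\<lambda>w. up r (\<lambda>w. y (One 1 # w)) w) w + s * y (One 1 # w) - down r y w)))"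
  define \<psi>' where "\<psi>' = (\<lambda>(z :: letter list + letter list + letter list \<Rightarrow> 'a) w.
    up r (\<lambda>v. z (Inl v)) w + z (Inr (Inl w)) +
      prepend (One 2) (\<lambda>w. s * z (Inl w) - z (Inr (Inr w)) - down r (\<lambda>v. z (Inr (Inl v))) w) w)"
  note lin = word_lin_intros linear_form_compose[OF linear_fun_other_part]
  have lin_\<phi>: "linear_fun \<phi>" "linear_fun \<phi>'" "linear_fun \<psi>" "linear_fun \<psi>'"
    unfolding \<phi>_def \<phi>'_def \<psi>_def \<psi>'_def by (intro linear_funI lin)+
  have CS: "?C \<subseteq> ?S" by (auto simp: other_words_def)
  have c1: "c (One (Suc 0) # w) = 0" if "c \<in> fsupp ?C" for w and c :: "letter list \<Rightarrow> 'a"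
    using that by (simp add: fsuppD[of c ?C])
  have q0: "?q (\<lambda>w. up r b w + c w + prepend (One 2) u w) = c"
    if "c \<in> fsupp ?C" for b c u :: "letter list \<Rightarrow> 'a"
  proof
    fix w
    have "prepend (One 2) u w = 0" if "w \<in> ?C"
      using that by (cases w) (auto simp: other_words_def)
    moreover have "(\<lambda>v. up r b (One 1 # v) + c (One 1 # v) + prepend (One 2) u (One 1 # v)) = b"
      using that assms by (simp add: c1)
    ultimately show "?q (\<lambda>w. up r b w + c w + prepend (One 2) u w) w = c w"
      using that by (auto simp: other_part_def dest: fsuppD)
  qed
  note supp = fsupp_up fsupp_down fsupp_One fsupp_add fsupp_diff fsupp_mult fsupp_prepend_One
     fsupp_other_part fsupp_mono[OF CS]
  have "lin_iso ?S (?W <+> ?C <+> ?W) \<phi> \<phi>'"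
    unfolding lin_iso_def
  proof (intro conjI ballI lin_\<phi>)
    fix x :: "letter list \<Rightarrow> 'a" assume x: "x \<in> fsupp ?S"
    show "\<phi> x \<in> fsupp (?W <+> ?C <+> ?W)"
      unfolding \<phi>_def using x by (simp add: supp)
    show "\<phi>' (\<phi> x) = x"
      unfolding \<phi>_def \<phi>'_def using decompose_word_vector[OF assms x] by simp
  next
    fix z :: "letter list + letter list + letter list \<Rightarrow> 'a" assume "z \<in> fsupp (?W <+> ?C <+> ?W)"
    then obtain a c b where z: "z = case_sum a (case_sum c b)" and abc: "a \<in> fsupp ?W" "c \<in> fsupp ?C" "b \<in> fsupp ?W"
      by (metis fsupp_Plus_cases)
    show "\<phi>' z \<in> fsupp ?S"
      unfolding \<phi>'_def z using assms abc by (simp add: supp)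
    show "\<phi> (\<phi>' z) = z"
      unfolding \<phi>_def \<phi>'_def z using assms abc(2)
      by (simp add: q0 down_linear down_prepend_One fun_eq_iff c1 split: sum.split)
  qed
  moreover have "lin_iso ?S (?W <+> ?C <+> ?W) \<psi> \<psi>'"
    unfolding lin_iso_def
  proof (intro conjI ballI lin_\<phi>)
    fix x :: "letter list \<Rightarrow> 'a" assume x: "x \<in> fsupp ?S"
    show "\<psi> x \<in> fsupp (?W <+> ?C <+> ?W)"
      unfolding \<psi>_def using x by (simp add: supp)
    show "\<psi>' (\<psi> x) = x"
      unfolding \<psi>_def \<psi>'_def using decompose_word_vector[OF assms x] by (simp add: algebra_simps)
  next
    fix z :: "letter list + letter list + letter list \<Rightarrow> 'a" assume "z \<in> fsupp (?W <+> ?C <+> ?W)"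
    then obtain a c b where z: "z = case_sum a (case_sum c b)" and abc: "a \<in> fsupp ?W" "c \<in> fsupp ?C" "b \<in> fsupp ?W"
      by (metis fsupp_Plus_cases)
    show "\<psi>' z \<in> fsupp ?S"
      unfolding \<psi>'_def z using assms abc by (simp add: supp)
    show "\<psi> (\<psi>' z) = z"
      unfolding \<psi>_def \<psi>'_def z using assms abc(2)
      by (simp add: q0 down_linear down_prepend_One fun_eq_iff c1 split: sum.split)
  qed
  moreover have "\<psi> (f x) = g (\<phi> x)" for x
  proof -
    have f: "f x = (\<lambda>w. up r (down r x) w + s * x w)"
      by (simp add: f_def s_def down_up algebra_simps)
    \<comment> \<open>\<open>other_part\<close> annihilates every \<open>up r z\<close>, since the
      \<open>One 1\<close> coordinate of that vector is \<open>z\<close>; only the term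
      \<open>s * x\<close> of \<open>f x\<close> survives.\<close>
    have "?q (f x) w = s * ?q x w" for w
      using assms by (simp add: other_part_def f up_linear algebra_simps)
    then show ?thesis
      using assms by (simp add: \<psi>_def f g_def \<phi>_def h_def N_def fun_eq_iff up_linear down_linear algebra_simps split: sum.split)
  qed
  moreover have "card ?S = card (?W <+> ?C <+> ?W)"
    using card_other_words[OF assms, of n] by (simp add: card_Plus finite_subset[OF CS])
  ultimately have "lin_equiv ?S f (?W <+> ?C <+> ?W) g"
    by (intro lin_equivI[of _ _ \<phi> \<phi>' \<psi> \<psi>']) (auto intro: finite_subset[OF CS])
  moreover have "smith (?W <+> ?C <+> ?W) g"
    unfolding g_def h_def N_def
    by (intro smith_Plus_id smith_mult Suc.IH finite_words finite_subset[OF CS])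
  ultimately show ?case
    unfolding f_def by (rule smith_lin_equiv)
qed

subsection \<open>Reduction of the Smith form for a single letter of value one\<close>

text \<open>For \<open>r = 1\<close> there is no second copy of the words of rank \<open>n\<close> in rank \<open>n + 1\<close>, and the
  induction runs instead over the maps \<open>(x, y) \<mapsto> (a (down (up x) + c x) + up y, c y)\<close>. In suitable
  coordinates such a map is \<open>id \<oplus> a T\<close> with \<open>T\<close> the map of the same shape one rank lower and with
  \<open>(c, c + 1)\<close> in place of \<open>(a, c)\<close>; that \<open>c\<close> and \<open>c + 1\<close> differ by a unit removes the coefficient \<open>c\<close>
  from the off-diagonal term \<open>c (up y)\<close> of \<open>T\<close>.\<close>
definition pair_map :: "nat \<Rightarrow> 'a::comm_ring_1 \<Rightarrow> 'a
    \<Rightarrow> (letter list + letter list \<Rightarrow> 'a) \<Rightarrow> letter list + letter list \<Rightarrow> 'a" where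
  "pair_map r a c z = case_sum
     (\<lambda>w. a * (down r (up r (\<lambda>v. z (Inl v))) w + c * z (Inl w)) + up r (\<lambda>v. z (Inr v)) w)
     (\<lambda>w. c * z (Inr w))"

text \<open>For r = 1 a nonempty valid word begins with \<open>One 1\<close> or \<open>Two\<close>,
  and \<open>up\<close> of the \<open>One 1\<close> coordinate contributes its \<open>down\<close>
  to the words beginning with \<open>Two\<close>. The rank is positive here, so the empty word has
  coordinate zero.\<close>

lemma decompose_word_vector_1:
  fixes x :: "letter list \<Rightarrow> 'a::comm_ring_1"
  assumes "r = 1" "x \<in> fsupp (words r (Suc (Suc k)))"
  shows "(\<lambda>w. up r (\<lambda>v. x (One 1 # v)) w + prepend Two (\<lambda>v. x (Two # v) - down r (\<lambda>v. x (One 1 # v)) v) w) = x"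
proof
  fix w
  show "up r (\<lambda>v. x (One 1 # v)) w + prepend Two (\<lambda>v. x (Two # v) - down r (\<lambda>v. x (One 1 # v)) v) w = x w"
    using assms fsuppD[OF assms(2), of w] by (cases w rule: word_cases) auto
qed

lemma smith_pair_map:
  fixes a c :: "'a::comm_ring_1"
  assumes "r = 1"
  shows "smith (words r (Suc k) <+> words r k) (pair_map r a c)"
proof (induction k arbitrary: a c)
  case 0
  show ?case
  \<comment> \<open>The second summand is empty because \<open>words r 0\<close> is, and DU is the
    identity in rank 0.\<close>
  proof (rule smith_diagonal[where c = "a * (1 + c)"])
    fix z :: "letter list + letter list \<Rightarrow> 'a" and w
    assume "z \<in> fsupp (words r (Suc 0) <+> words r 0)"
    then obtain x where z: "z = case_sum x (\<lambda>_. 0)" and x: "x \<in> fsupp (words r (Suc 0))"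
      by (elim fsupp_Plus_cases) (simp add: fsupp_0)
    have "down r x = (\<lambda>_. 0)"
      using fsupp_down[OF x] by (simp add: fsupp_0)
    then show "pair_map r a c z w = a * (1 + c) * z w"
      using assms by (simp add: z pair_map_def down_up up_linear algebra_simps split: sum.split)
  qed simp
next
  case (Suc k)
  let ?S = "words r (Suc (Suc k))" and ?W = "words r (Suc k)" and ?V = "words r k"
  define N where "N = (\<lambda>(x :: letter list \<Rightarrow> 'a) w. down r (\<lambda>v. up r x v) w + (c + 1) * x w)"
  \<comment> \<open>The first component is the \<open>One 1\<close> coordinate of the image. The
    second input vector y enters it with coefficient 1 and can therefore be recovered from
    it.\<close>
  define \<phi> where "\<phi> = (\<lambda>z :: letter list + letter list \<Rightarrow> 'a. case_sum
     (\<lambda>w. a * (N (\<lambda>v. z (Inl (One 1 # v))) w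
            + up r (\<lambda>v. z (Inl (Two # v)) - down r (\<lambda>v. z (Inl (One 1 # v))) v) w) + z (Inr w))
     (case_sum (\<lambda>w. z (Inl (One 1 # w))) (\<lambda>w. down r (\<lambda>v. z (Inl (One 1 # v))) w - z (Inl (Two # w)))))"
  define \<phi>' where "\<phi>' = (\<lambda>z :: letter list + letter list + letter list \<Rightarrow> 'a. case_sum
     (\<lambda>w. up r (\<lambda>v. z (Inr (Inl v))) w + prepend Two (\<lambda>v. - z (Inr (Inr v))) w)
     (\<lambda>w. z (Inl w) - a * (N (\<lambda>v. z (Inr (Inl v))) w - up r (\<lambda>v. z (Inr (Inr v))) w)))"
  \<comment> \<open>Let (X, Y) be the image, with coordinates X1 and X2 of X. Then c X1 - Y is free
    of y. With d = D x1 - x2 it contains U d with coefficient -ac, and subtracting U (X2 - D X1)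
    adds a(c + 1), so a remains.\<close>
  define \<psi> where "\<psi> = (\<lambda>z :: letter list + letter list \<Rightarrow> 'a. case_sum
     (\<lambda>w. z (Inl (One 1 # w)))
     (case_sum
       (\<lambda>w. c * z (Inl (One 1 # w)) - z (Inr w)
          - up r (\<lambda>v. z (Inl (Two # v)) - down r (\<lambda>v. z (Inl (One 1 # v))) v) w)
       (\<lambda>w. down r (\<lambda>v. z (Inl (One 1 # v))) w - z (Inl (Two # w)))))"
  define \<psi>' where "\<psi>' = (\<lambda>z :: letter list + letter list + letter list \<Rightarrow> 'a. case_sum
     (\<lambda>w. up r (\<lambda>v. z (Inl v)) w + prepend Two (\<lambda>v. - z (Inr (Inr v))) w)
     (\<lambda>w. c * z (Inl w) - z (Inr (Inl w)) + up r (\<lambda>v. z (Inr (Inr v))) w))"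
  define g where "g = (\<lambda>z :: letter list + letter list + letter list \<Rightarrow> 'a.
    case_sum (\<lambda>i. z (Inl i)) ((\<lambda>y j. a * pair_map r c (c + 1) y j) (\<lambda>j. z (Inr j))))"
  have lin_\<phi>: "linear_fun \<phi>" "linear_fun \<phi>'" "linear_fun \<psi>" "linear_fun \<psi>'"
    unfolding \<phi>_def \<phi>'_def \<psi>_def \<psi>'_def N_def by (intro linear_funI word_lin_intros)+
  have fsupp_Two': "(\<lambda>w. x (Two # w)) \<in> fsupp ?V" if "x \<in> fsupp ?S" for x :: "letter list \<Rightarrow> 'a"
    using fsupp_Two[OF that] by simp
  note supp = fsupp_up fsupp_down fsupp_One fsupp_Two' fsupp_add fsupp_diff fsupp_minus fsupp_mult fsupp_prepend_Two
  have N: "N x \<in> fsupp ?W" if "x \<in> fsupp ?W" for x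
    unfolding N_def using that by (simp add: supp)
  have "lin_iso (?S <+> ?W) (?W <+> ?W <+> ?V) \<phi> \<phi>'"
    unfolding lin_iso_def
  proof (intro conjI ballI lin_\<phi>)
    fix z :: "letter list + letter list \<Rightarrow> 'a" assume "z \<in> fsupp (?S <+> ?W)"
    then obtain x y where z: "z = case_sum x y" and xy: "x \<in> fsupp ?S" "y \<in> fsupp ?W"
      by (metis fsupp_Plus_cases)
    show "\<phi> z \<in> fsupp (?W <+> ?W <+> ?V)"
      unfolding \<phi>_def z using xy by (simp add: supp N)
    show "\<phi>' (\<phi> z) = z"
      unfolding \<phi>_def \<phi>'_def z using decompose_word_vector_1[OF assms xy(1)]
      by (simp add: fun_eq_iff up_linear algebra_simps split: sum.split)
  next
    fix z :: "letter list + letter list + letter list \<Rightarrow> 'a" assume "z \<in> fsupp (?W <+> ?W <+> ?V)"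
    then obtain a b d where z: "z = case_sum a (case_sum b d)" and abd: "a \<in> fsupp ?W" "b \<in> fsupp ?W" "d \<in> fsupp ?V"
      by (metis fsupp_Plus_cases)
    show "\<phi>' z \<in> fsupp (?S <+> ?W)"
      unfolding \<phi>'_def z using abd by (simp add: supp N)
    show "\<phi> (\<phi>' z) = z"
      unfolding \<phi>_def \<phi>'_def z using assms
      by (simp add: up_linear fun_eq_iff split: sum.split)
  qed
  moreover have "lin_iso (?S <+> ?W) (?W <+> ?W <+> ?V) \<psi> \<psi>'"
    unfolding lin_iso_def
  proof (intro conjI ballI lin_\<phi>)
    fix z :: "letter list + letter list \<Rightarrow> 'a" assume "z \<in> fsupp (?S <+> ?W)"
    then obtain x y where z: "z = case_sum x y" and xy: "x \<in> fsupp ?S" "y \<in> fsupp ?W"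
      by (metis fsupp_Plus_cases)
    show "\<psi> z \<in> fsupp (?W <+> ?W <+> ?V)"
      unfolding \<psi>_def z using xy by (simp add: supp)
    show "\<psi>' (\<psi> z) = z"
      unfolding \<psi>_def \<psi>'_def z using decompose_word_vector_1[OF assms xy(1)]
      by (simp add: fun_eq_iff up_linear algebra_simps split: sum.split)
  next
    fix z :: "letter list + letter list + letter list \<Rightarrow> 'a" assume "z \<in> fsupp (?W <+> ?W <+> ?V)"
    then obtain a b d where z: "z = case_sum a (case_sum b d)" and abd: "a \<in> fsupp ?W" "b \<in> fsupp ?W" "d \<in> fsupp ?V"
      by (metis fsupp_Plus_cases)
    show "\<psi>' z \<in> fsupp (?S <+> ?W)"
      unfolding \<psi>'_def z using abd by (simp add: supp)
    show "\<psi> (\<psi>' z) = z"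
      unfolding \<psi>_def \<psi>'_def z using assms
      by (simp add: up_linear fun_eq_iff split: sum.split)
  qed
  moreover have "\<psi> (pair_map r a c z) = g (\<phi> z)" for z
  proof -
    define x y x\<^sub>1 x\<^sub>2 where "x = (\<lambda>v. z (Inl v))" and y: "y = (\<lambda>v. z (Inr v))"
      and x1: "x\<^sub>1 = (\<lambda>v. z (Inl (One 1 # v)))" and x2: "x\<^sub>2 = (\<lambda>v. z (Inl (Two # v)))"
    have down_x: "down r x = (\<lambda>w. x\<^sub>1 w + up r x\<^sub>2 w)"
      unfolding down_def x1 x2 x_def using assms by simp
    have du: "down r (up r x) = (\<lambda>w. x w + up r (down r x) w)" for x :: "letter list \<Rightarrow> 'a"
      unfolding down_up using assms by simp
    have p1: "pair_map r a c z (Inl (One 1 # w)) = a * ((c + 2) * x\<^sub>1 w + up r x\<^sub>2 w) + y w" for w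
    proof -
      have "pair_map r a c z (Inl (One 1 # w)) = a * (x\<^sub>1 w + down r x w + c * x\<^sub>1 w) + y w"
        unfolding pair_map_def x_def[symmetric] y[symmetric] du using assms by (simp add: x_def x1)
      then show ?thesis by (simp add: down_x algebra_simps)
    qed
    have p2: "pair_map r a c z (Inl (Two # w)) =
        a * ((c + 2) * x\<^sub>2 w + down r x\<^sub>1 w + up r (down r x\<^sub>2) w) + down r y w" for w
    proof -
      have "pair_map r a c z (Inl (Two # w)) = a * (x\<^sub>2 w + down r (down r x) w + c * x\<^sub>2 w) + down r y w"
        unfolding pair_map_def x_def[symmetric] y[symmetric] du by (simp add: x_def x2)
      then show ?thesis by (simp add: down_x down_linear du algebra_simps)
    qed
    have p3: "pair_map r a c z (Inr w) = c * y w" for w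
      by (simp add: pair_map_def y)
    \<comment> \<open>Both terms contain D y, which cancels; DU x2 = x2 + U D x2 removes U D x2 and
      lowers c + 2 to c + 1.\<close>
    have p4: "pair_map r a c z (Inl (Two # w)) - down r (\<lambda>w. pair_map r a c z (Inl (One 1 # w))) w =
        a * ((c + 1) * (x\<^sub>2 w - down r x\<^sub>1 w))" for w
      unfolding p1 p2 down_linear du by (simp add: algebra_simps)
    have \<phi>: "\<phi> z = case_sum (\<lambda>w. a * ((c + 2) * x\<^sub>1 w + up r x\<^sub>2 w) + y w)
        (case_sum x\<^sub>1 (\<lambda>w. down r x\<^sub>1 w - x\<^sub>2 w))"
      unfolding \<phi>_def N_def x1[symmetric] x2[symmetric] du up_linear
      by (simp add: x1 x2 y fun_eq_iff algebra_simps split: sum.split)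
    have p5: "down r (\<lambda>w. pair_map r a c z (Inl (One 1 # w))) w - pair_map r a c z (Inl (Two # w)) =
        a * ((c + 1) * (down r x\<^sub>1 w - x\<^sub>2 w))" for w
      using p4[of w] by (simp add: algebra_simps)
    have "\<psi> (pair_map r a c z) = case_sum (\<lambda>w. a * ((c + 2) * x\<^sub>1 w + up r x\<^sub>2 w) + y w)
        (case_sum (\<lambda>w. a * (c * ((c + 2) * x\<^sub>1 w + up r x\<^sub>2 w) - (c + 1) * (up r x\<^sub>2 w - up r (down r x\<^sub>1) w)))
           (\<lambda>w. a * ((c + 1) * (down r x\<^sub>1 w - x\<^sub>2 w))))"
      unfolding \<psi>_def p4 p5 unfolding p1 p3 up_linear
      by (simp add: fun_eq_iff split: sum.split) (simp add: algebra_simps)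
    also have "\<dots> = g (\<phi> z)"
      unfolding \<phi> g_def pair_map_def
      by (simp add: fun_eq_iff du up_linear split: sum.split) (simp add: algebra_simps)
    finally show ?thesis .
  qed
  moreover have "card (?S <+> ?W) = card (?W <+> ?W <+> ?V)"
    using card_words_Suc_Suc[of r k] assms by (simp add: card_Plus)
  ultimately have "lin_equiv (?S <+> ?W) (pair_map r a c) (?W <+> ?W <+> ?V) g"
    by (intro lin_equivI[of _ _ \<phi> \<phi>' \<psi> \<psi>']) auto
  moreover have "smith (?W <+> ?W <+> ?V) g"
    unfolding g_def by (intro smith_Plus_id smith_mult Suc.IH finite_words)
  ultimately show ?case
    by (rule smith_lin_equiv)
qed

text \<open>Entry into the induction on \<open>pair_map\<close>. The coordinates x1 and x2 - D x1
  are used on both sides; the second one kills the image of \<open>up\<close>, so in them UD + (t +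
  1) is block triangular, namely \<open>pair_map r 1 (t + 1)\<close>.\<close>

lemma smith_down_up_eq_1:
  fixes t :: "'a::comm_ring_1"
  assumes "r = 1"
  shows "smith (words r (Suc n)) (\<lambda>x w. down r (up r x) w + t * x w)"
proof (cases n)
  case 0
  then show ?thesis using smith_down_up_0 by simp
next
  case (Suc k)
  let ?S = "words r (Suc (Suc k))" and ?W = "words r (Suc k)" and ?V = "words r k"
  define f where "f = (\<lambda>(x :: letter list \<Rightarrow> 'a) w. down r (up r x) w + t * x w)"
  define \<phi> where "\<phi> = (\<lambda>x :: letter list \<Rightarrow> 'a. case_sum (\<lambda>w. x (One 1 # w))
    (\<lambda>w. x (Two # w) - down r (\<lambda>v. x (One 1 # v)) w))"
  define \<phi>' where "\<phi>' = (\<lambda>(z :: letter list + letter list \<Rightarrow> 'a) w.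
    up r (\<lambda>v. z (Inl v)) w + prepend Two (\<lambda>v. z (Inr v)) w)"
  have lin_\<phi>: "linear_fun \<phi>" "linear_fun \<phi>'"
    unfolding \<phi>_def \<phi>'_def by (intro linear_funI word_lin_intros)+
  have "lin_iso ?S (?W <+> ?V) \<phi> \<phi>'"
    unfolding lin_iso_def
  proof (intro conjI ballI lin_\<phi>)
    fix x :: "letter list \<Rightarrow> 'a" assume x: "x \<in> fsupp ?S"
    show "\<phi> x \<in> fsupp (?W <+> ?V)"
      unfolding \<phi>_def using x fsupp_Two[OF x] by (simp add: fsupp_One fsupp_diff fsupp_down)
    show "\<phi>' (\<phi> x) = x"
      unfolding \<phi>_def \<phi>'_def using decompose_word_vector_1[OF assms x] by simp
  next
    fix z :: "letter list + letter list \<Rightarrow> 'a" assume "z \<in> fsupp (?W <+> ?V)"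
    then obtain x y where z: "z = case_sum x y" and xy: "x \<in> fsupp ?W" "y \<in> fsupp ?V"
      by (metis fsupp_Plus_cases)
    show "\<phi>' z \<in> fsupp ?S"
      unfolding \<phi>'_def z using xy by (simp add: fsupp_add fsupp_up fsupp_prepend_Two)
    show "\<phi> (\<phi>' z) = z"
      unfolding \<phi>_def \<phi>'_def z using assms by (simp add: fun_eq_iff split: sum.split)
  qed
  moreover have "\<phi> (f x) = pair_map r 1 (t + 1) (\<phi> x)" if "x \<in> fsupp ?S" for x
  proof -
    define y where "y = (\<lambda>w. x (One 1 # w))"
    define u where "u = (\<lambda>w. x (Two # w) - down r y w)"
    have x: "x = (\<lambda>w. up r y w + prepend Two u w)"
      using decompose_word_vector_1[OF assms that] by (simp add: y_def u_def)
    have "\<phi> x = case_sum y u"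
      by (simp add: \<phi>_def y_def u_def)
    moreover have "\<phi> (f x) = case_sum (\<lambda>w. down r (up r y) w + up r u w + (t + 1) * y w) (\<lambda>w. (t + 1) * u w)"
    proof -
      have f: "f x = (\<lambda>w. up r (down r x) w + (t + 1) * x w)"
        unfolding f_def down_up using assms by (simp add: algebra_simps)
      have "\<phi> (f x) = case_sum (\<lambda>w. down r x w + (t + 1) * y w) (\<lambda>w. (t + 1) * u w)"
        unfolding \<phi>_def f using assms
        by (simp add: y_def u_def down_linear fun_eq_iff algebra_simps split: sum.split)
      moreover have "down r x = (\<lambda>w. down r (up r y) w + up r u w)"
        by (subst x) (simp add: down_linear down_prepend_Two)
      ultimately show ?thesis by simp
    qed
    ultimately show ?thesis
      by (simp add: pair_map_def algebra_simps fun_eq_iff split: sum.split)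
  qed
  moreover have "card ?S = card (?W <+> ?V)"
    using card_words_Suc_Suc[of r k] assms by (simp add: card_Plus)
  ultimately have "lin_equiv ?S f (?W <+> ?V) (pair_map r 1 (t + 1))"
    by (intro lin_equivI[of _ _ \<phi> \<phi>' \<phi> \<phi>']) auto
  then show ?thesis
    unfolding f_def Suc by (rule smith_lin_equiv) (rule smith_pair_map[OF assms])
qed

lemma smith_down_up:
  assumes "r \<ge> 1"
  shows "smith (words r (Suc n)) (\<lambda>x w. down r (up r x) w + t * x w)"
proof (cases "r = 1")
  case True
  then show ?thesis by (rule smith_down_up_eq_1)
next
  case False
  with assms show ?thesis by (intro smith_down_up_ge_2) simp
qed

subsection \<open>Matrices of linear maps\<close>

definition unit_fun :: "'i \<Rightarrow> 'i \<Rightarrow> 'a::comm_ring_1" where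
  "unit_fun i j = (if j = i then 1 else 0)"

definition vec_fun :: "'i list \<Rightarrow> 'a::comm_ring_1 vec \<Rightarrow> 'i \<Rightarrow> 'a" where
  "vec_fun xs v i = (\<Sum>k<length xs. v $ k * unit_fun (xs ! k) i)"

definition fun_vec :: "'i list \<Rightarrow> ('i \<Rightarrow> 'a) \<Rightarrow> 'a vec" where
  "fun_vec xs x = vec (length xs) (\<lambda>k. x (xs ! k))"

definition fun_mat :: "'i list \<Rightarrow> 'j list \<Rightarrow> (('i \<Rightarrow> 'a::comm_ring_1) \<Rightarrow> 'j \<Rightarrow> 'a) \<Rightarrow> 'a mat" where
  "fun_mat xs ys f = mat (length ys) (length xs) (\<lambda>(i, j). f (unit_fun (xs ! j)) (ys ! i))"

lemma fun_mat_dim [simp]: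
  "dim_row (fun_mat xs ys f) = length ys" "dim_col (fun_mat xs ys f) = length xs"
  "fun_mat xs ys f \<in> carrier_mat (length ys) (length xs)"
  by (simp_all add: fun_mat_def)

lemma vec_fun_nth:
  assumes "distinct xs" "k < length xs"
  shows "vec_fun xs v (xs ! k) = v $ k"
proof -
  have "vec_fun xs v (xs ! k) = (\<Sum>j<length xs. if j = k then v $ j else 0)"
    unfolding vec_fun_def unit_fun_def
    using assms by (intro sum.cong) (auto simp: nth_eq_iff_index_eq)
  then show ?thesis
    using assms by simp
qed

lemma vec_fun_fsupp: "vec_fun xs v \<in> fsupp (set xs)"
  by (rule fsuppI) (auto simp: vec_fun_def unit_fun_def intro!: sum.neutral)

lemma fun_eq_fsuppI:
  assumes "x \<in> fsupp S" "y \<in> fsupp S" "\<And>i. i \<in> S \<Longrightarrow> x i = y i"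
  shows "x = y"
  using assms by (metis fsuppD ext)

lemma vec_fun_fun_vec:
  assumes "distinct xs" "x \<in> fsupp (set xs)"
  shows "vec_fun xs (fun_vec xs x) = x"
proof (rule fun_eq_fsuppI[OF vec_fun_fsupp assms(2)])
  show "vec_fun xs (fun_vec xs x) i = x i" if "i \<in> set xs" for i
    using that assms(1) by (auto simp: in_set_conv_nth vec_fun_nth fun_vec_def)
qed

lemma linear_fun_vec_fun:
  assumes "linear_fun f"
  shows "f (vec_fun xs v) j = (\<Sum>k<length xs. v $ k * f (unit_fun (xs ! k)) j)"
proof -
  have "vec_fun xs v = (\<lambda>i. \<Sum>k<length xs. v $ k * unit_fun (xs ! k) i)"
    by (simp add: fun_eq_iff vec_fun_def)
  then show ?thesis
    by (simp add: linear_fun_sum[OF assms] linear_fun_mult[OF assms])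
qed

lemma fun_mat_mult_vec:
  assumes "linear_fun f" "v \<in> carrier_vec (length xs)"
  shows "fun_mat xs ys f *\<^sub>v v = fun_vec ys (f (vec_fun xs v))"
  using assms(2) by (intro eq_vecI)
    (auto simp: fun_vec_def fun_mat_def scalar_prod_def linear_fun_vec_fun[OF assms(1)]
      atLeast0LessThan mult.commute intro!: sum.cong)

lemma fun_mat_mult:
  assumes "distinct ys" "linear_fun g" "\<And>i. i \<in> set xs \<Longrightarrow> f (unit_fun i) \<in> fsupp (set ys)"
  shows "fun_mat ys zs g * fun_mat xs ys f = fun_mat xs zs (\<lambda>x. g (f x))"
proof (rule eq_matI)
  fix i j assume "i < dim_row (fun_mat xs zs (\<lambda>x. g (f x)))" "j < dim_col (fun_mat xs zs (\<lambda>x. g (f x)))"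
  then have i: "i < length zs" and j: "j < length xs" by simp_all
  let ?u = "f (unit_fun (xs ! j))"
  have "g ?u (zs ! i) = (\<Sum>k<length ys. ?u (ys ! k) * g (unit_fun (ys ! k)) (zs ! i))"
    using linear_fun_vec_fun[OF assms(2), of ys "fun_vec ys ?u" "zs ! i"]
      vec_fun_fun_vec[OF assms(1) assms(3)[OF nth_mem[OF j]]] by (simp add: fun_vec_def)
  then show "(fun_mat ys zs g * fun_mat xs ys f) $$ (i, j) = fun_mat xs zs (\<lambda>x. g (f x)) $$ (i, j)"
    using i j by (simp add: fun_mat_def scalar_prod_def atLeast0LessThan mult.commute)
qed simp_all

lemma unit_fun_fsupp: "i \<in> S \<Longrightarrow> unit_fun i \<in> fsupp S"
  by (auto simp: fsupp_def unit_fun_def)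

lemma lin_iso_fun_mat_mult:
  assumes "lin_iso S T f g" "set xs = S" "set ys = T" "distinct xs" "distinct ys"
  shows "fun_mat ys xs g * fun_mat xs ys f = 1\<^sub>m (length xs)"
proof -
  have "fun_mat ys xs g * fun_mat xs ys f = fun_mat xs xs (\<lambda>x. g (f x))"
    using assms by (intro fun_mat_mult) (auto simp: lin_iso_def unit_fun_fsupp)
  also have "\<dots> = 1\<^sub>m (length xs)"
  proof (rule eq_matI)
    fix i j assume "i < dim_row (1\<^sub>m (length xs) :: 'c mat)" "j < dim_col (1\<^sub>m (length xs) :: 'c mat)"
    then show "fun_mat xs xs (\<lambda>x. g (f x)) $$ (i, j) = 1\<^sub>m (length xs) $$ (i, j)"
      using assms by (auto simp: fun_mat_def lin_iso_def unit_fun_fsupp)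
        (auto simp: unit_fun_def nth_eq_iff_index_eq)
  qed simp_all
  finally show ?thesis .
qed

lemma lin_iso_sym: "lin_iso S T f g \<Longrightarrow> lin_iso T S g f"
  by (auto simp: lin_iso_def)

lemma lin_iso_invertible_mat:
  assumes "lin_iso S T f g" "set xs = S" "set ys = T" "distinct xs" "distinct ys" "length xs = length ys"
  shows "invertible_mat (fun_mat xs ys f)"
  using lin_iso_fun_mat_mult[OF assms(1-5)] lin_iso_fun_mat_mult[OF lin_iso_sym[OF assms(1)] assms(3,2,5,4)] assms(6)
  unfolding invertible_mat_def inverts_mat_def by (intro conjI exI[of _ "fun_mat ys xs g"]) auto

text \<open>Divisibility is only a preorder, as associated entries divide each other. Sorting
  therefore uses a numerical key, the number of indices whose entry divides the given one;
  comparability makes a smaller or equal key imply divisibility.\<close>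

lemma dvd_sorted_list:
  fixes d :: "'i \<Rightarrow> 'a::comm_monoid_mult"
  assumes "finite S" "\<And>i j. i \<in> S \<Longrightarrow> j \<in> S \<Longrightarrow> d i dvd d j \<or> d j dvd d i"
  obtains xs where "distinct xs" "set xs = S" "\<And>k. Suc k < length xs \<Longrightarrow> d (xs ! k) dvd d (xs ! Suc k)"
proof -
  define key where "key i = card {k \<in> S. d k dvd d i}" for i
  have key: "d i dvd d j" if "i \<in> S" "j \<in> S" "key i \<le> key j" for i j
  proof (rule ccontr)
    assume *: "\<not> d i dvd d j"
    then have "d j dvd d i" using assms(2) that by blast
    then have "{k \<in> S. d k dvd d j} \<subset> {k \<in> S. d k dvd d i}"
      using * that by (auto intro: dvd_trans)
    then have "key j < key i"
      unfolding key_def using assms(1) by (intro psubset_card_mono) auto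
    with that show False by simp
  qed
  obtain ys where ys: "set ys = S" "distinct ys"
    using finite_distinct_list[OF assms(1)] by blast
  let ?xs = "sort_key key ys"
  have "d (?xs ! k) dvd d (?xs ! Suc k)" if "Suc k < length ?xs" for k
  proof (rule key)
    have "?xs ! k \<in> set ?xs" "?xs ! Suc k \<in> set ?xs"
      using that by (simp_all del: set_sort length_sort)
    then show "?xs ! k \<in> S" "?xs ! Suc k \<in> S"
      using ys by simp_all
    have "map key ?xs ! k \<le> map key ?xs ! Suc k"
      using that by (intro sorted_nth_mono) simp_all
    then show "key (?xs ! k) \<le> key (?xs ! Suc k)"
      using that by simp
  qed
  with that[of ?xs] ys show thesis by simp
qed

text \<open>Take for P the matrix of \<psi> and for Q that of the inverse \<phi>'. The product
  represents \<psi> f \<phi>', the diagonal map, and the outer bases are listed in the sorted order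
  \<open>ys\<close>.\<close>

lemma smith_has_smith_form:
  fixes f :: "('i \<Rightarrow> 'a::comm_ring_1) \<Rightarrow> 'i \<Rightarrow> 'a"
  assumes "smith S f" "linear_fun f" "\<And>x. x \<in> fsupp S \<Longrightarrow> f x \<in> fsupp S" "distinct xs" "set xs = S"
  shows "has_smith_form (fun_mat xs xs f)"
proof -
  obtain d \<phi> \<phi>' \<psi> \<psi>' where d: "\<forall>i\<in>S. \<forall>j\<in>S. d i dvd d j \<or> d j dvd d i"
    and \<phi>: "lin_iso S S \<phi> \<phi>'" and \<psi>: "lin_iso S S \<psi> \<psi>'"
    and eq: "\<And>x. x \<in> fsupp S \<Longrightarrow> \<psi> (f x) = (\<lambda>i. d i * \<phi> x i)"
    using assms by (auto simp: smith_def lin_equiv_def)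
  obtain ys where ys: "distinct ys" "set ys = S" and
    sorted: "\<And>k. Suc k < length ys \<Longrightarrow> d (ys ! k) dvd d (ys ! Suc k)"
    using dvd_sorted_list[of S d] d assms(5) by blast
  have len: "length ys = length xs"
    using ys assms(4,5) by (metis distinct_card)
  define P where "P = fun_mat xs ys \<psi>"
  define Q where "Q = fun_mat ys xs \<phi>'"
  have inv: "invertible_mat P" "invertible_mat Q"
    unfolding P_def Q_def
    using lin_iso_invertible_mat[OF \<psi> assms(5) ys(2) assms(4) ys(1)]
      lin_iso_invertible_mat[OF lin_iso_sym[OF \<phi>] ys(2) assms(5) ys(1) assms(4)] len by simp_all
  have lin: "linear_fun \<psi>" "linear_fun (\<lambda>x. \<psi> (f x))"
    using \<psi> assms(2) by (auto simp: lin_iso_def linear_fun_compose[OF _ assms(2)])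
  have "P * fun_mat xs xs f = fun_mat xs ys (\<lambda>x. \<psi> (f x))"
    unfolding P_def using assms lin by (intro fun_mat_mult) (auto simp: unit_fun_fsupp)
  moreover have "fun_mat xs ys (\<lambda>x. \<psi> (f x)) * Q = fun_mat ys ys (\<lambda>x. \<psi> (f (\<phi>' x)))"
    unfolding Q_def using assms(4,5) lin(2) \<phi> ys unit_fun_fsupp[of _ S]
    by (intro fun_mat_mult) (auto simp: lin_iso_def)
  ultimately have PAQ: "P * fun_mat xs xs f * Q = fun_mat ys ys (\<lambda>x. \<psi> (f (\<phi>' x)))"
    by simp
  have entry: "fun_mat ys ys (\<lambda>x. \<psi> (f (\<phi>' x))) $$ (i, j) = (if i = j then d (ys ! i) else 0)"
    if "i < length ys" "j < length ys" for i j
  proof -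
    have u: "unit_fun (ys ! j) \<in> fsupp S"
      using unit_fun_fsupp[of "ys ! j" S] ys that by auto
    then have "\<psi> (f (\<phi>' (unit_fun (ys ! j)))) = (\<lambda>i. d i * unit_fun (ys ! j) i)"
      using eq[of "\<phi>' (unit_fun (ys ! j))"] \<phi> by (auto simp: lin_iso_def)
    then show ?thesis
      using that ys by (simp add: fun_mat_def unit_fun_def nth_eq_iff_index_eq)
  qed
  have "in_smith_form (P * fun_mat xs xs f * Q)"
    unfolding PAQ in_smith_form_def using entry sorted by simp
  then show ?thesis
    unfolding has_smith_form_def using inv len
    by (intro exI[of _ P] exI[of _ Q]) (simp add: P_def Q_def carrier_matI)
qed

section \<open>The cover relation and the matrices of \<open>up\<close> and
  \<open>down\<close>\<close>

lemma covers_Nil: "\<not> covers r [] v"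
  by (simp add: covers_def)

lemma replicate_Two_eq_Cons:
  "One i # w = replicate k Two @ b # v \<longleftrightarrow> k = 0 \<and> b = One i \<and> v = w"
  "Two # w = replicate k Two @ b # v \<longleftrightarrow>
     k = 0 \<and> b = Two \<and> v = w \<or> (\<exists>l. k = Suc l \<and> w = replicate l Two @ b # v)"
  by (cases k; auto)+

lemma covers_One: "covers r (One i # w) v \<longleftrightarrow> valid_word r (One i # w) \<and> v = w"
  by (auto simp: covers_def replicate_Two_eq_Cons)

lemma covers_Two:
  "covers r (Two # w) v \<longleftrightarrow>
     valid_word r w \<and> ((\<exists>i. 1 \<le> i \<and> i \<le> r \<and> v = One i # w) \<or> (\<exists>u. v = Two # u \<and> covers r w u))"
  (is "?l \<longleftrightarrow> ?r")
proof
  assume ?l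
  then show ?r
    unfolding covers_def replicate_Two_eq_Cons by fastforce
next
  assume ?r
  then consider i where "valid_word r w" "1 \<le> i" "i \<le> r" "v = One i # w"
    | u where "valid_word r w" "v = Two # u" "covers r w u" by blast
  then show ?l
  proof cases
    case 1
    then have "Two # w = replicate 0 Two @ Two # w \<and> v = replicate 0 Two @ One i # w" by simp
    with 1 show ?thesis unfolding covers_def by (metis valid_word_simps(2,3))
  next
    case 2
    from 2(3) consider (a) k i x where "1 \<le> i" "i \<le> r" "w = replicate k Two @ Two # x" "u = replicate k Two @ One i # x"
      | (b) k i x where "w = replicate k Two @ One i # x" "u = replicate k Two @ x"
      unfolding covers_def by blast
    moreover have "valid_word r u" using 2(3) by (simp add: covers_def)
    ultimately show ?thesis
    proof cases
      case a
      then have "Two # w = replicate (Suc k) Two @ Two # x" "v = replicate (Suc k) Two @ One i # x"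
        using 2 by simp_all
      with a(1,2) 2(1,2) \<open>valid_word r u\<close> show ?thesis unfolding covers_def by (metis valid_word_simps(3))
    next
      case b
      then have "Two # w = replicate (Suc k) Two @ One i # x" "v = replicate (Suc k) Two @ x"
        using 2 by simp_all
      with 2(1,2) \<open>valid_word r u\<close> show ?thesis unfolding covers_def by (metis valid_word_simps(3))
    qed
  qed
qed

lemma covers_valid: "covers r w v \<Longrightarrow> valid_word r w \<and> valid_word r v"
  by (simp add: covers_def)

text \<open>Stripping \<open>Two\<close> from \<open>w = Two # u\<close> turns the claim for (v, w)
  into the claim for (u, v), with the roles exchanged; hence the induction on the total
  length.\<close>

lemma covers_Two_iff: "covers r (Two # v) w \<longleftrightarrow> covers r w v"
proof (induction "length v + length w" arbitrary: v w rule: less_induct)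
  case less
  show ?case
  proof (cases w rule: word_cases)
    case (3 u)
    have "covers r (Two # v) w \<longleftrightarrow> covers r v u"
      using 3 covers_valid[of r v u] by (auto simp: covers_Two[of r v])
    also have "\<dots> \<longleftrightarrow> covers r w v"
      using less[of u v] 3 by simp
    finally show ?thesis .
  qed (auto simp: covers_Two covers_One covers_Nil)
qed

lemma up_unit_fun:
  assumes "valid_word r w" "valid_word r v"
  shows "up r (unit_fun v) w = (if covers r w v then 1 else 0)"
  using assms
proof (induction w arbitrary: v)
  case (Cons a w)
  show ?case
  proof (cases a)
    case (One i)
    then show ?thesis using Cons.prems by (auto simp: covers_One unit_fun_def)
  next
    case Two
    have up: "up r (unit_fun v) (a # w) =
        (\<Sum>i=1..r. unit_fun v (One i # w)) + up r (\<lambda>u. unit_fun v (Two # u)) w"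
      unfolding Two by (rule up.simps)
    show ?thesis
    proof (cases v rule: word_cases)
      case (2 j u)
      have "(\<lambda>u. unit_fun v (Two # u)) = (\<lambda>_. 0 :: 'a)"
        by (simp add: 2 unit_fun_def)
      moreover have "(\<Sum>i=1..r. unit_fun v (One i # w) :: 'a) = (if w = u then 1 else 0)"
      proof -
        have "(\<Sum>i=1..r. unit_fun v (One i # w) :: 'a) = (\<Sum>i=1..r. if i = j then (if w = u then 1 else 0) else 0)"
          by (intro sum.cong) (auto simp: unit_fun_def 2)
        then show ?thesis using Cons.prems 2 by simp
      qed
      ultimately show ?thesis
        unfolding up using Cons.prems by (auto simp: Two 2 covers_Two up_linear)
    next
      case (3 u)
      have "(\<lambda>u. unit_fun v (Two # u)) = (unit_fun u :: _ \<Rightarrow> 'a)"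
        by (simp add: 3 unit_fun_def fun_eq_iff)
      moreover have "(\<Sum>i=1..r. unit_fun v (One i # w)) = (0 :: 'a)"
        by (simp add: 3 unit_fun_def)
      ultimately show ?thesis
        unfolding up using Cons.prems Cons.IH[of u] by (auto simp: Two 3 covers_Two)
    qed (unfold up, simp add: Two covers_Two unit_fun_def up_linear)
  qed
qed (simp add: covers_Nil)

lemma down_unit_fun:
  assumes "valid_word r w" "valid_word r v"
  shows "down r (unit_fun w) v = (if covers r w v then 1 else 0)"
  using up_unit_fun[of r "Two # v" w] assms by (simp add: covers_Two_iff)

lemma Plist: "distinct (Plist r n)" "set (Plist r n) = words r (Suc n)"
proof -
  have "\<exists>xs. distinct xs \<and> set xs = Pset r n"
    using finite_distinct_list[OF finite_words[of r "Suc n"]] by (auto simp: words_Suc)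
  from someI_ex[OF this] show "distinct (Plist r n)" "set (Plist r n) = words r (Suc n)"
    unfolding Plist_def words_Suc by auto
qed

lemma length_Plist: "length (Plist r n) = pcard r n"
  using distinct_card[OF Plist(1)[of r n]] by (simp add: Plist(2) pcard_def words_Suc)

lemma Plist_nth: "i < pcard r n \<Longrightarrow> Plist r n ! i \<in> words r (Suc n)"
  by (metis Plist(2) length_Plist nth_mem)

lemma valid_Plist: "i < pcard r n \<Longrightarrow> valid_word r (Plist r n ! i)"
  using Plist_nth by (auto simp: words_def)

lemma Umat_eq: "Umat r n = fun_mat (Plist r n) (Plist r (Suc n)) (up r)"
  by (rule eq_matI) (simp_all add: Umat_def fun_mat_def length_Plist up_unit_fun valid_Plist)

text \<open>\<open>Umat\<close> has integer entries while the Smith form is sought over integer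
  polynomials, so both matrices are identified over a general ring through
  \<open>of_int\<close>.\<close>

lemma fun_mat_up: "fun_mat (Plist r n) (Plist r (Suc n)) (up r) = map_mat of_int (Umat r n)"
  and fun_mat_down: "fun_mat (Plist r (Suc n)) (Plist r n) (down r) = transpose_mat (map_mat of_int (Umat r n))"
  by (rule eq_matI; simp add: Umat_def fun_mat_def length_Plist up_unit_fun down_unit_fun valid_Plist)+

lemma DUt_eq:
  "DUt r n = fun_mat (Plist r n) (Plist r n) (\<lambda>x w. down r (up r x) w + [:0, 1:] * x w)"
proof -
  let ?p = "Plist r n" and ?U = "map_mat of_int (Umat r n) :: int poly mat"
  have "fun_mat ?p ?p (\<lambda>x. down r (up r x) :: _ \<Rightarrow> int poly) = transpose_mat ?U * ?U"
    unfolding fun_mat_down[symmetric, of r n] unfolding fun_mat_up[symmetric, of r n]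
    by (rule fun_mat_mult[symmetric])
      (auto simp: Plist linear_fun_down intro!: fsupp_up unit_fun_fsupp)
  then have *: "fun_mat ?p ?p (\<lambda>x. down r (up r x) :: _ \<Rightarrow> int poly) $$ (i, j) = (transpose_mat ?U * ?U) $$ (i, j)" for i j
    by simp
  show ?thesis
  proof (rule eq_matI)
    fix i j
    assume "i < dim_row (fun_mat ?p ?p (\<lambda>x w. down r (up r x) w + [:0, 1:] * x w :: int poly))"
      "j < dim_col (fun_mat ?p ?p (\<lambda>x w. down r (up r x) w + [:0, 1:] * x w :: int poly))"
    then have ij: "i < pcard r n" "j < pcard r n" by (simp_all add: length_Plist)
    have "[:DUmat r n $$ (i, j):] = (of_int (DUmat r n $$ (i, j)) :: int poly)"
      by (simp add: of_int_poly)
    also have "\<dots> = (transpose_mat ?U * ?U) $$ (i, j)"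
      using ij by (simp add: DUmat_def Dmat_def Umat_def scalar_prod_def)
    also have "\<dots> = down r (up r (unit_fun (?p ! j))) (?p ! i)"
      using *[of i j] ij by (simp add: fun_mat_def length_Plist)
    finally show "DUt r n $$ (i, j) = fun_mat ?p ?p (\<lambda>x w. down r (up r x) w + [:0, 1:] * x w) $$ (i, j)"
      using ij Plist(1)[of r n]
      by (simp add: DUt_def DUmat_def Dmat_def Umat_def fun_mat_def length_Plist unit_fun_def nth_eq_iff_index_eq)
  qed (simp_all add: DUt_def DUmat_def Dmat_def Umat_def length_Plist)
qed

lemma has_smith_form_DUt:
  assumes "r \<ge> 1"
  shows "has_smith_form (DUt r n)"
  unfolding DUt_eq
proof (rule smith_has_smith_form[OF smith_down_up[OF assms]])
  show "linear_fun (\<lambda>(x :: letter list \<Rightarrow> int poly) w. down r (up r x) w + [:0, 1:] * x w)"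
    by (intro linear_funI word_lin_intros)
qed (use Plist in \<open>auto simp del: mult_pCons_left intro!: fsupp_add fsupp_mult fsupp_down fsupp_up\<close>)

subsection \<open>Rank sizes\<close>

lemma pcard_Suc_Suc: "pcard r (Suc (Suc n)) = r * pcard r (Suc n) + pcard r n"
  and pcard_0: "pcard r 0 = 1" and pcard_1: "pcard r (Suc 0) = r"
  using card_words_Suc_Suc[of r "Suc n"] card_words_Suc_Suc[of r 0] words_1[of r]
  by (simp_all add: pcard_def words_Suc)

text \<open>The convention p_{-1} = 0 makes the recurrence valid at k = 1; at k = 0 it would give 0
  instead of 1.\<close>

lemma pz_rec:
  assumes "k \<ge> 1"
  shows "pz r k = int r * pz r (k - 1) + pz r (k - 2)"
proof (cases "nat k")
  case (Suc n)
  then have k: "k = int n + 1" by simp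
  show ?thesis
  proof (cases n)
    case (Suc m)
    then have "nat k = Suc (Suc m)" "nat (k - 1) = Suc m" "nat (k - 2) = m"
      using k by auto
    then show ?thesis
      using k Suc by (simp add: pz_def pcard_Suc_Suc)
  qed (use k in \<open>simp add: pz_def pcard_0 pcard_1\<close>)
qed (use assms in simp)

lemma pz_nonneg: "pz r k \<ge> 0"
  by (simp add: pz_def)

lemma pz_neg: "k < 0 \<Longrightarrow> pz r k = 0"
  by (simp add: pz_def)

lemma pz_mono:
  assumes "r \<ge> 1" "k \<le> l"
  shows "pz r k \<le> pz r l"
  using assms(2)
proof (induction l rule: int_ge_induct)
  case (step l)
  have "pz r l \<le> pz r (l + 1)"
  proof (cases "l \<ge> 0")
    case True
    then have "pz r (l + 1) = int r * pz r l + pz r (l - 1)"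
      using pz_rec[of "l + 1" r] by simp
    moreover have "1 * pz r l \<le> int r * pz r l"
      using assms(1) pz_nonneg by (intro mult_right_mono) auto
    ultimately show ?thesis using pz_nonneg[of r "l - 1"] by simp
  qed (simp add: pz_neg pz_nonneg)
  with step show ?case by simp
qed simp

text \<open>For l >= 0, p_{l+1} - p_l = (r - 1) p_l + p_{l-1}, which for r >= 2 is at least p_l,
  hence at least p_l - p_{l-1}.\<close>

lemma dp_mono:
  assumes "r \<ge> 2" "k \<le> l"
  shows "dp r k \<le> dp r l"
  using assms(2)
proof (induction l rule: int_ge_induct)
  case (step l)
  have "dp r l \<le> dp r (l + 1)"
  proof (cases "l \<ge> 0")
    case True
    then have "pz r (l + 1) = int r * pz r l + pz r (l - 1)"
      using pz_rec[of "l + 1" r] by simp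
    moreover have "2 * pz r l \<le> int r * pz r l"
      using assms(1) pz_nonneg by (intro mult_right_mono) auto
    ultimately show ?thesis using pz_nonneg[of r "l - 1"] by (simp add: dp_def)
  next
    case False
    then show ?thesis by (simp add: dp_def pz_neg pz_nonneg)
  qed
  with step show ?case by simp
qed simp

text \<open>For r = 1 the sizes are Fibonacci numbers and the differences are again sizes, p_{k-2}
  for k >= 1. The exception is the difference 1 at k = 0, which exceeds the difference 0 at k = 1;
  this is why a gap of two is required.\<close>

lemma dp_le_dp_1:
  assumes "1 \<le> n" "m + 2 \<le> n"
  shows "dp 1 m \<le> dp 1 n"
proof -
  have dp: "dp 1 k = pz 1 (k - 2)" if "k \<ge> 1" for k
    using pz_rec[OF that, of 1] by (simp add: dp_def)
  consider "m < 0" | "m = 0" | "m \<ge> 1" by linarith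
  then show ?thesis
  proof cases
    case 1
    then show ?thesis using dp[OF assms(1)] pz_nonneg by (simp add: dp_def pz_neg)
  next
    case 2
    then have "dp 1 m = pz 1 0" by (simp add: dp_def pz_neg)
    then show ?thesis using dp[OF assms(1)] pz_mono[of 1 0 "n - 2"] assms 2 by simp
  next
    case 3
    then show ?thesis using dp[OF 3] dp[OF assms(1)] pz_mono[of 1 "m - 2" "n - 2"] assms by simp
  qed
qed

lemma dp_le_dp:
  assumes "r \<ge> 1" "1 \<le> n" "1 \<le> j" "j \<le> n"
  shows "dp r (int n - int j - (if r = 1 then 1 else 0)) \<le> dp r (int n)"
proof (cases "r = 1")
  case True
  then show ?thesis using dp_le_dp_1[of "int n" "int n - int j - 1"] assms by simp
next
  case False
  with assms show ?thesis by (simp add: dp_mono)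
qed

subsection \<open>The cokernel of the up map\<close>

lemma group_int_vec_group: "group (int_vec_group m)"
proof (rule groupI)
  show "\<exists>y\<in>carrier (int_vec_group m). y \<otimes>\<^bsub>int_vec_group m\<^esub> x = \<one>\<^bsub>int_vec_group m\<^esub>"
    if "x \<in> carrier (int_vec_group m)" for x
    using that by (intro bexI[of _ "- x"]) (auto simp: int_vec_group_def)
qed (auto simp: int_vec_group_def)

lemma vec_fun_add:
  assumes "v \<in> carrier_vec (length xs)" "u \<in> carrier_vec (length xs)"
  shows "vec_fun xs (v + u) = (\<lambda>i. vec_fun xs v i + vec_fun xs u i)"
  using assms by (simp add: fun_eq_iff vec_fun_def sum.distrib[symmetric] algebra_simps)

lemma fun_vec_vec_fun:
  assumes "distinct xs" "v \<in> carrier_vec (length xs)"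
  shows "fun_vec xs (vec_fun xs v) = v"
  using assms by (intro eq_vecI) (auto simp: fun_vec_def vec_fun_nth)

lemma lookup_Abs_poly_mapping_bounded:
  "(\<And>i. i \<ge> m \<Longrightarrow> f i = 0) \<Longrightarrow> Poly_Mapping.lookup (Abs_poly_mapping f) = f" for f :: "nat \<Rightarrow> int"
  by (rule lookup_Abs_poly_mapping) (rule finite_subset[of _ "{..<m}"], auto simp: not_less[symmetric])

text \<open>Since \<open>up r y (One 1 # v) = y v\<close>, the map \<open>x \<mapsto> x - up r (\<lambda>v. x (One 1 # v))\<close> vanishes exactly
  on the image of \<open>up r\<close> and fixes the vectors supported on words not starting with \<open>One 1\<close>.\<close>
lemma free_abelian_coker_Umat:
  assumes "r \<ge> 1"
  shows "free_abelian (coker (Umat r n))"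
proof -
  define ps where "ps = Plist r (Suc n)"
  define m where "m = length ps"
  have ps: "distinct ps" "set ps = words r (Suc (Suc n))" and m: "m = pcard r (Suc n)"
    by (simp_all add: ps_def Plist m_def length_Plist)
  define red where "red x w = x w - up r (\<lambda>v. x (One 1 # v)) w" for x :: "letter list \<Rightarrow> int" and w
  define h where "h v = Abs_poly_mapping (\<lambda>i. if i < m then red (vec_fun ps v) (ps ! i) else 0)" for v
  \<comment> \<open>Positions in the list \<open>ps\<close> stand for words, because the free
    abelian group is to be indexed by natural numbers; the words not starting with
    \<open>One 1\<close> index a basis of the cokernel.\<close>
  define N where "N = {i. i < m \<and> (\<forall>v. ps ! i \<noteq> One 1 # v)}"
  let ?G = "int_vec_group m" and ?H = "free_Abelian_group N"
  have lookup_h: "Poly_Mapping.lookup (h v) = (\<lambda>i. if i < m then red (vec_fun ps v) (ps ! i) else 0)" for v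
    unfolding h_def by (rule lookup_Abs_poly_mapping_bounded[of m]) simp
  have red_One: "red x (One 1 # w) = 0" for x w
    using assms by (simp add: red_def)
  have "h \<in> hom ?G ?H"
  proof (rule homI)
    show "h v \<in> carrier ?H" for v
      using red_One by (auto simp: in_keys_iff lookup_h N_def split: if_splits)
    show "h (v \<otimes>\<^bsub>?G\<^esub> u) = h v \<otimes>\<^bsub>?H\<^esub> h u" if "v \<in> carrier ?G" "u \<in> carrier ?G" for v u
      using that by (intro poly_mapping_eqI)
        (simp add: lookup_h lookup_add int_vec_group_def vec_fun_add m_def red_def up_linear)
  qed
  then interpret group_hom ?G ?H h
    by (simp add: group_hom_def group_hom_axioms_def group_int_vec_group)
  have "h ` carrier ?G = carrier ?H"
  proof
    show "h ` carrier ?G \<subseteq> carrier ?H" using hom_closed by blast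
    show "carrier ?H \<subseteq> h ` carrier ?G"
    proof
      fix p assume "p \<in> carrier ?H"
      then have p: "Poly_Mapping.lookup p i = 0" if "i \<notin> N" for i
        using that by (auto simp: in_keys_iff)
      define v where "v = vec m (Poly_Mapping.lookup p)"
      have v: "vec_fun ps v (ps ! i) = Poly_Mapping.lookup p i" if "i < m" for i
        using that vec_fun_nth[OF ps(1), of i v] by (simp add: m_def v_def)
      have "vec_fun ps v (One 1 # w) = 0" for w
      proof (cases "One 1 # w \<in> set ps")
        case True
        then obtain i where "i < m" "ps ! i = One 1 # w"
          by (auto simp: in_set_conv_nth m_def)
        then show ?thesis using v[of i] p[of i] by (auto simp: N_def)
      qed (use vec_fun_fsupp in \<open>blast intro: fsuppD\<close>)
      then have "red (vec_fun ps v) w = vec_fun ps v w" for w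
        unfolding red_def by (simp add: up_linear)
      then have "h v = p"
        using v p by (intro poly_mapping_eqI) (auto simp: lookup_h N_def)
      then show "p \<in> h ` carrier ?G"
        by (intro image_eqI[of _ _ v]) (simp_all add: int_vec_group_def v_def)
    qed
  qed
  then have "?G Mod kernel ?G ?H h \<cong> ?H"
    by (rule FactGroup_iso)
  moreover have "kernel ?G ?H h = {Umat r n *\<^sub>v x | x. x \<in> carrier_vec (dim_col (Umat r n))}"
  proof (intro equalityI subsetI)
    fix v assume "v \<in> kernel ?G ?H h"
    then have v: "v \<in> carrier_vec m" and hv: "h v = 0"
      by (auto simp: kernel_def int_vec_group_def)
    define x where "x = vec_fun ps v"
    define y where "y = (\<lambda>w. x (One 1 # w))"
    have x: "x \<in> fsupp (words r (Suc (Suc n)))"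
      unfolding x_def ps(2)[symmetric] by (rule vec_fun_fsupp)
    then have y: "y \<in> fsupp (words r (Suc n))"
      unfolding y_def by (rule fsupp_One)
    \<comment> \<open>The vanishing of \<open>red x\<close> on all words of this rank says exactly
      that \<open>x\<close> is the image of its own \<open>One 1\<close> coordinate.\<close>
    have "x = up r y"
    proof (rule fun_eq_fsuppI[OF x fsupp_up[OF y]])
      fix w assume "w \<in> words r (Suc (Suc n))"
      then obtain i where i: "i < m" "w = ps ! i"
        unfolding ps(2)[symmetric] by (auto simp: in_set_conv_nth m_def)
      have "red x w = Poly_Mapping.lookup (h v) i"
        unfolding lookup_h i x_def using i(1) by simp
      then show "x w = up r y w"
        unfolding red_def y_def hv by simp
    qed
    then have "v = fun_vec ps (up r (vec_fun (Plist r n) (fun_vec (Plist r n) y)))"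
      using fun_vec_vec_fun[OF ps(1), of v] v y by (simp add: vec_fun_fun_vec Plist x_def m_def)
    also have "\<dots> = Umat r n *\<^sub>v fun_vec (Plist r n) y"
      unfolding Umat_eq ps_def by (subst fun_mat_mult_vec[OF linear_fun_up]) (auto simp: fun_vec_def)
    finally show "v \<in> {Umat r n *\<^sub>v x | x. x \<in> carrier_vec (dim_col (Umat r n))}"
      by (auto simp: Umat_eq fun_vec_def)
  next
    fix v assume "v \<in> {Umat r n *\<^sub>v x | x. x \<in> carrier_vec (dim_col (Umat r n))}"
    then obtain u where u: "u \<in> carrier_vec (length (Plist r n))" and v: "v = Umat r n *\<^sub>v u"
      by (auto simp: Umat_eq)
    define y where "y = vec_fun (Plist r n) u"
    have "v = fun_vec ps (up r y)"
      unfolding v Umat_eq ps_def y_def by (rule fun_mat_mult_vec[OF linear_fun_up u])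
    moreover have "y \<in> fsupp (words r (Suc n))"
      unfolding y_def by (metis Plist(2) vec_fun_fsupp)
    ultimately have "vec_fun ps v = up r y"
      using ps by (simp add: vec_fun_fun_vec fsupp_up)
    then have "red (vec_fun ps v) w = 0" for w
      using assms by (simp add: red_def)
    then have "h v = 0"
      by (intro poly_mapping_eqI) (simp add: lookup_h)
    moreover have "v \<in> carrier_vec m"
      unfolding v Umat_eq using u by (simp add: m_def ps_def fun_mat_mult_vec linear_fun_up fun_vec_def)
    ultimately show "v \<in> kernel ?G ?H h"
      by (simp add: kernel_def int_vec_group_def)
  qed
  moreover have "dim_row (Umat r n) = m"
    by (simp add: Umat_def m)
  ultimately show ?thesis
    unfolding free_abelian_def coker_def by auto
qed

theorem theorem5p1:
  fixes r :: nat
  assumes "r \<ge> 1"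
  shows "(\<forall>n. has_smith_form (DUt r n))
       \<and> (\<forall>n j. 1 \<le> n \<and> 1 \<le> j \<and> j \<le> n \<longrightarrow>
            dp r (int n) \<ge> dp r (int n - int j - (if r = 1 then 1 else 0)))
       \<and> (\<forall>n. free_abelian (coker (Umat r n)))"
  using has_smith_form_DUt dp_le_dp free_abelian_coker_Umat assms by blast

end
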